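(* Let $I$ be an arbitrary index set, $c\in\mathbb{R}^n$, and for each $\alpha\in I$ let $U_\alpha\subseteq\mathbb{R}^{n}\times\mathbb{R}$ be non-empty, compact and convex; put $\natural(\mathbf{U}):=\prod_{\alpha\in I}U_\alpha$. Consider the robust problem $\mathbf{RO}(\natural(\mathbf{U}))$: $\inf_{x\in\mathbb{R}^n}\langle c,x\rangle$ subject to $\langle a^\alpha,x\rangle\ge b^\alpha$ for all $(a^\alpha,b^\alpha)\in U_\alpha$ and all $\alpha\in I$. Suppose that: 1. $\mathbf{RO}(\natural(\mathbf{U}))$ satisfies the strong Slater condition with strong Slater constant $\rho>0$, i.e. there is $x_0\in\mathbb{R}^n$ with $\langle a^\alpha,x_0\rangle\ge b^\alpha+\rho$ for all $(a^\alpha,b^\alpha)\in U_\alpha$, $\alpha\in I$; 2. $F^{\mathrm{opt}}(\mathbf{RO}(\natural(\mathbf{U})))$ is non-empty and bounded; 3. $\sup\{-b^\alpha:(a^\alpha,b^\alpha)\in U_\alpha,\ \alpha\in I\}<+\infty$. Let $T:=I\times\mathbb{R}^n\times\mathbb{R}$. Then the linear semi-infinite problem $\pi_{\natural(\mathbf{U})}:=(c,\sigma_{\natural(\mathbf{U})})$ indexed by $T$, where $$\sigma_{\natural(\mathbf{U})}((\alpha,t,s)):=\begin{cases}(t,s)&\text{if }(t,s)\in U_\alpha,\\(0_n,-\rho)&\text{if }(t,s)\notin U_\alpha,\end{cases}$$ belongs to $\mathrm{int}(\Pi_s)$, and for any $\epsilon$ satisfying $0<\epsilon<\delta^{\Pi}(\pi_{\natural(\mathbf{U})},\mathrm{bd}(\Pi_s))$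 and for all $\natural(\mathbf{V})=\prod_{\alpha\in I}V_\alpha$ with compact and convex $V_\alpha\subseteq\mathbb{R}^n\times\mathbb{R}$ satisfying $\sup_{\alpha\in I}d_H(U_\alpha,V_\alpha)<\epsilon$, $$|\nu(\mathbf{RO}(\natural(\mathbf{U})))-\nu(\mathbf{RO}(\natural(\mathbf{V})))|\le L(\natural(\mathbf{U}),\epsilon)\,\mathbf{d}_\natural(\natural(\mathbf{U}),\natural(\mathbf{V})),$$ where $\mathbf{RO}(\natural(\mathbf{V}))$ has the same cost vector $c$, and $L(\natural(\mathbf{U}),\epsilon):=L(\pi_{\natural(\mathbf{U})},\epsilon)$ is the explicit constant defined in the context.
   Context: $\|\cdot\|$ is the Euclidean norm, $\langle\cdot,\cdot\rangle$ the dot product, $0_n$ the zero vector of $\mathbb{R}^n$. Distances from a point to a set are infima of distances to its elements ($\inf\varnothing=+\infty$). Robust problems: $\nu(\mathbf{RO}(\cdot))$ is the optimal value and $F^{\mathrm{opt}}(\mathbf{RO}(\cdot))$ the set of optimal solutions. $d_H(C,D):=\max\{\sup_{u\in C}\inf_{v\in D}\|u-v\|,\ \sup_{v\in D}\inf_{u\in C}\|u-v\|\}$ is the Hausdorff distance, and $\mathbf{d}_\natural(\natural(\mathbf{U}),\natural(\mathbf{V})):=\sup_{\alpha\in I}d_H(U_\alpha,V_\alpha)$. Linear semi-infinite (LSIO) problems: for an index set $T$ (no structure assumed), a constraint system is $\sigma=(a,b)$ with $a:T\to\mathbb{R}^n$, $b:T\to\mathbb{R}$, written $\sigma(t)=(a_t,b_t)\in\mathbb{R}^{n+1}$;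 $\Sigma:=(\mathbb{R}^n\times\mathbb{R})^T$ is the set of all constraint systems. An LSIO problem is $\pi=(c,\sigma)\in\Pi:=\mathbb{R}^n\times\Sigma$, representing $\inf_x\langle c,x\rangle$ subject to $\langle a_t,x\rangle\ge b_t$ for all $t\in T$. Put $F(\sigma):=\{x:\langle a_t,x\rangle\ge b_t\ \forall t\in T\}$, $\nu(\pi):=\inf\{\langle c,x\rangle:x\in F(\sigma)\}$ ($+\infty$ if $F(\sigma)=\varnothing$), $F^{\mathrm{opt}}(\pi):=\{x\in F(\sigma):\langle c,x\rangle=\nu(\pi)\}$. Define $\delta^{\Sigma}(\sigma_1,\sigma_2):=\sup_{t\in T}\|(a^1_t,b^1_t)-(a^2_t,b^2_t)\|$ and $\delta^{\Pi}(\pi_1,\pi_2):=\max\{\|c^1-c^2\|,\delta^{\Sigma}(\sigma_1,\sigma_2)\}$ (values may be $+\infty$). Interior ($\mathrm{int}$) and boundary ($\mathrm{bd}$) in $\Sigma$, $\Pi$ are with respect to these. $\Sigma_i:=\{\sigma\in\Sigma:F(\sigma)=\varnothing\}$; $\Pi_s:=\{\pi\in\Pi:F^{\mathrm{opt}}(\pi)\ne\varnothing\}$. Constant $L$: for $\pi_0=(c^0,\sigma_0)\in\mathrm{int}(\Pi_s)$ with $\sigma_0=(a_t,b_t)_{t\in T}$ and $0<\epsilon<\delta^{\Pi}(\pi_0,\mathrm{bd}(\Pi_s))$, let $\varphi(\lambda)=\varphi_*(\lambda):=\sqrt{1+\lambda^2}$, $\psi(\alpha):=(1+\alpha)\sqrt{1+\alpha^2}$,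 $R(\pi_0):=\{-b_t:t\in T\}\cup\{\nu(\pi_0)\}$, $Z^-(\pi_0):=\mathrm{conv}(\{a_t:t\in T\}\cup\{-c^0\})$, and $$\widehat\rho(\pi_0):=\frac{\sup R(\pi_0)}{d_*(0_n,\mathrm{bd}(Z^-(\pi_0)))},\qquad \beta(\pi_0,\epsilon):=\frac{\psi(\widehat\rho(\pi_0))}{\delta^{\Sigma}(\sigma_0,\Sigma_i)-\epsilon},$$ $$\gamma(\pi_0,\epsilon):=\varphi_*(0)\big(\widehat\rho(\pi_0)+\epsilon\beta(\pi_0,\epsilon)\big)+\|c^0\|_*\beta(\pi_0,\epsilon),\qquad \mu(\pi_0,\epsilon):=\varphi(0)\frac{\sup R(\pi_0)+\epsilon\max\{1,\gamma(\pi_0,\epsilon)\}}{d(0_n,\mathrm{bd}(Z^-(\pi_0)))-\epsilon},$$ $$L(\pi_0,\epsilon):=\varphi_*(0)\left((\epsilon+\|c^0\|)\frac{\psi(\mu(\pi_0,\epsilon))}{\delta^{\Sigma}(\sigma_0,\Sigma_i)-\epsilon}+\mu(\pi_0,\epsilon)\right).$$ Here $d$ is Euclidean distance (with $x/(+\infty)=0$), and the dual norm $\|\cdot\|_*$ (with distance $d_*$) coincides with the Euclidean one. *)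

theory Defs
  imports "HOL-Analysis.Analysis"
begin

section \<open>Extended distances\<close>

text \<open>
  Distances take values in \<^typ>\<open>ennreal\<close>, so that an infimum over the empty set is \<open>\<infinity>\<close> and a
  supremum over the empty set is \<open>0\<close>.
\<close>

definition set_edist :: "('a \<Rightarrow> 'b \<Rightarrow> ennreal) \<Rightarrow> 'a \<Rightarrow> 'b set \<Rightarrow> ennreal" where
  "set_edist d x S = (INF y\<in>S. d x y)"

definition norm_edist :: "'a::real_normed_vector \<Rightarrow> 'a \<Rightarrow> ennreal" where
  "norm_edist x y = ennreal (norm (x - y))"

definition hausdorff_edist :: "'a::real_normed_vector set \<Rightarrow> 'a set \<Rightarrow> ennreal" where
  "hausdorff_edist C D =
     max (SUP u\<in>C. INF v\<in>D. norm_edist u v) (SUP v\<in>D. INF u\<in>C. norm_edist u v)"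

text \<open>
  The topology on a carrier \<open>M\<close> induced by an extended distance \<open>d\<close>; interior and boundary are the
  library's \<^const>\<open>interior_of\<close> and \<^const>\<open>frontier_of\<close>.
\<close>

definition edist_topology :: "'a set \<Rightarrow> ('a \<Rightarrow> 'a \<Rightarrow> ennreal) \<Rightarrow> 'a topology" where
  "edist_topology M d =
     topology (\<lambda>W. W \<subseteq> M \<and> (\<forall>p\<in>W. \<exists>r>0. \<forall>q\<in>M. d p q < r \<longrightarrow> q \<in> W))"

lemma openin_edist_topology:
  "openin (edist_topology M d) W \<longleftrightarrow>
     W \<subseteq> M \<and> (\<forall>p\<in>W. \<exists>r>0. \<forall>q\<in>M. d p q < r \<longrightarrow> q \<in> W)"
proof -
  let ?L = "\<lambda>W. W \<subseteq> M \<and> (\<forall>p\<in>W. \<exists>r>0. \<forall>q\<in>M. d p q < r \<longrightarrow> q \<in> W)"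
  have "?L (A \<inter> B)" if A: "?L A" and B: "?L B" for A B
  proof (intro conjI ballI)
    show "A \<inter> B \<subseteq> M" using A by blast
    fix p assume p: "p \<in> A \<inter> B"
    obtain r where r: "r > 0" "\<forall>q\<in>M. d p q < r \<longrightarrow> q \<in> A" using A p by blast
    obtain s where s: "s > 0" "\<forall>q\<in>M. d p q < s \<longrightarrow> q \<in> B" using B p by blast
    have "min r s > 0" "\<forall>q\<in>M. d p q < min r s \<longrightarrow> q \<in> A \<inter> B"
      using r s by auto
    then show "\<exists>r>0. \<forall>q\<in>M. d p q < r \<longrightarrow> q \<in> A \<inter> B" by blast
  qed
  moreover have "?L (\<Union>\<K>)" if K: "\<forall>A\<in>\<K>. ?L A" for \<K>
  proof (intro conjI ballI)
    show "\<Union>\<K> \<subseteq> M" using K by blast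
    fix p assume "p \<in> \<Union>\<K>"
    then obtain A where A: "A \<in> \<K>" "p \<in> A" by blast
    then obtain r where "r > 0" "\<forall>q\<in>M. d p q < r \<longrightarrow> q \<in> A" using K by blast
    with A show "\<exists>r>0. \<forall>q\<in>M. d p q < r \<longrightarrow> q \<in> \<Union>\<K>" by blast
  qed
  ultimately have "istopology ?L"
    unfolding istopology_def by blast
  then show ?thesis
    unfolding edist_topology_def by (simp only: topology_inverse')
qed

lemma topspace_edist_topology [simp]: "topspace (edist_topology M d) = M"
proof -
  have "openin (edist_topology M d) M"
    unfolding openin_edist_topology by (auto intro: exI[of _ 1])
  moreover have "topspace (edist_topology M d) \<subseteq> M"
    using openin_topspace[of "edist_topology M d"] unfolding openin_edist_topology by blast
  ultimately show ?thesis
    using openin_subset by blast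
qed


section \<open>Linear semi-infinite problems\<close>

text \<open>
  A constraint system assigns to an index \<open>t\<close> the pair \<open>(a\<^sub>t, b\<^sub>t)\<close>; the product norm on
  \<^typ>\<open>(real^'n) \<times> real\<close> is the Euclidean one. The index set is an arbitrary set \<open>T\<close>, and systems are
  the extensional functions on \<open>T\<close>.
\<close>

type_synonym ('t, 'n) lsio_system = "'t \<Rightarrow> (real^'n) \<times> real"
type_synonym ('t, 'n) lsio_problem = "(real^'n) \<times> ('t, 'n) lsio_system"

definition all_systems :: "'t set \<Rightarrow> ('t, 'n::finite) lsio_system set" where
  "all_systems T = T \<rightarrow>\<^sub>E UNIV"

definition all_problems :: "'t set \<Rightarrow> ('t, 'n::finite) lsio_problem set" where
  "all_problems T = UNIV \<times> all_systems T"

definition lsio_feasible :: "'t set \<Rightarrow> ('t, 'n::finite) lsio_system \<Rightarrow> (real^'n) set" where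
  "lsio_feasible T \<sigma> = {x. \<forall>t\<in>T. fst (\<sigma> t) \<bullet> x \<ge> snd (\<sigma> t)}"

definition lsio_value :: "'t set \<Rightarrow> ('t, 'n::finite) lsio_problem \<Rightarrow> ereal" where
  "lsio_value T \<pi> = (INF x\<in>lsio_feasible T (snd \<pi>). ereal (fst \<pi> \<bullet> x))"

definition lsio_opt :: "'t set \<Rightarrow> ('t, 'n::finite) lsio_problem \<Rightarrow> (real^'n) set" where
  "lsio_opt T \<pi> = {x \<in> lsio_feasible T (snd \<pi>). ereal (fst \<pi> \<bullet> x) = lsio_value T \<pi>}"

definition delta_system ::
    "'t set \<Rightarrow> ('t, 'n::finite) lsio_system \<Rightarrow> ('t, 'n) lsio_system \<Rightarrow> ennreal" where
  "delta_system T \<sigma>\<^sub>1 \<sigma>\<^sub>2 = (SUP t\<in>T. norm_edist (\<sigma>\<^sub>1 t) (\<sigma>\<^sub>2 t))"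

definition delta_problem ::
    "'t set \<Rightarrow> ('t, 'n::finite) lsio_problem \<Rightarrow> ('t, 'n) lsio_problem \<Rightarrow> ennreal" where
  "delta_problem T \<pi>\<^sub>1 \<pi>\<^sub>2 =
     max (norm_edist (fst \<pi>\<^sub>1) (fst \<pi>\<^sub>2)) (delta_system T (snd \<pi>\<^sub>1) (snd \<pi>\<^sub>2))"

definition problem_topology :: "'t set \<Rightarrow> ('t, 'n::finite) lsio_problem topology" where
  "problem_topology T = edist_topology (all_problems T) (delta_problem T)"

definition inconsistent_systems :: "'t set \<Rightarrow> ('t, 'n::finite) lsio_system set" where
  "inconsistent_systems T = {\<sigma> \<in> all_systems T. lsio_feasible T \<sigma> = {}}"

definition solvable_problems :: "'t set \<Rightarrow> ('t, 'n::finite) lsio_problem set" where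
  "solvable_problems T = {\<pi> \<in> all_problems T. lsio_opt T \<pi> \<noteq> {}}"


section \<open>The Lipschitz constant\<close>

text \<open>
  The dual norm is the Euclidean norm itself, hence \<open>phi\<close> also plays the role of \<open>\<phi>\<^sub>*\<close>. The
  quotients below are formed in \<^typ>\<open>ereal\<close>, where \<open>x / \<infinity> = 0\<close>, and then converted to \<^typ>\<open>real\<close>.
  For a problem in the interior of the solvable ones whose right-hand sides satisfy
  \<open>sup (- b\<^sub>t) < \<infinity>\<close>, and for \<open>\<epsilon>\<close> below its distance to the boundary, the numerators are finite and
  the denominators are positive, so that the conversion loses nothing; outside this range the
  values are meaningless.
\<close>

definition phi :: "real \<Rightarrow> real" where
  "phi l = sqrt (1 + l\<^sup>2)"

definition psi :: "real \<Rightarrow> real" where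
  "psi \<alpha> = (1 + \<alpha>) * sqrt (1 + \<alpha>\<^sup>2)"

definition R_set :: "'t set \<Rightarrow> ('t, 'n::finite) lsio_problem \<Rightarrow> ereal set" where
  "R_set T \<pi> = (\<lambda>t. ereal (- snd (snd \<pi> t))) ` T \<union> {lsio_value T \<pi>}"

definition Z_minus :: "'t set \<Rightarrow> ('t, 'n::finite) lsio_problem \<Rightarrow> (real^'n) set" where
  "Z_minus T \<pi> = convex hull ((\<lambda>t. fst (snd \<pi> t)) ` T \<union> {- fst \<pi>})"

definition dist_bd_Z :: "'t set \<Rightarrow> ('t, 'n::finite) lsio_problem \<Rightarrow> ereal" where
  "dist_bd_Z T \<pi> = enn2ereal (set_edist norm_edist 0 (frontier (Z_minus T \<pi>)))"

definition dist_inconsistent :: "'t set \<Rightarrow> ('t, 'n::finite) lsio_problem \<Rightarrow> ereal" where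
  "dist_inconsistent T \<pi> =
     enn2ereal (set_edist (delta_system T) (snd \<pi>) (inconsistent_systems T))"

definition rho_hat :: "'t set \<Rightarrow> ('t, 'n::finite) lsio_problem \<Rightarrow> real" where
  "rho_hat T \<pi> = real_of_ereal (Sup (R_set T \<pi>) / dist_bd_Z T \<pi>)"

definition beta_const :: "'t set \<Rightarrow> ('t, 'n::finite) lsio_problem \<Rightarrow> real \<Rightarrow> real" where
  "beta_const T \<pi> \<epsilon> =
     real_of_ereal (ereal (psi (rho_hat T \<pi>)) / (dist_inconsistent T \<pi> - ereal \<epsilon>))"

definition gamma_const :: "'t set \<Rightarrow> ('t, 'n::finite) lsio_problem \<Rightarrow> real \<Rightarrow> real" where
  "gamma_const T \<pi> \<epsilon> =
     phi 0 * (rho_hat T \<pi> + \<epsilon> * beta_const T \<pi> \<epsilon>) + norm (fst \<pi>) * beta_const T \<pi> \<epsilon>"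

definition mu_const :: "'t set \<Rightarrow> ('t, 'n::finite) lsio_problem \<Rightarrow> real \<Rightarrow> real" where
  "mu_const T \<pi> \<epsilon> =
     phi 0 * real_of_ereal
       ((Sup (R_set T \<pi>) + ereal (\<epsilon> * max 1 (gamma_const T \<pi> \<epsilon>))) / (dist_bd_Z T \<pi> - ereal \<epsilon>))"

definition lipschitz_const :: "'t set \<Rightarrow> ('t, 'n::finite) lsio_problem \<Rightarrow> real \<Rightarrow> real" where
  "lipschitz_const T \<pi> \<epsilon> =
     phi 0 * ((\<epsilon> + norm (fst \<pi>)) *
         real_of_ereal (ereal (psi (mu_const T \<pi> \<epsilon>)) / (dist_inconsistent T \<pi> - ereal \<epsilon>))
       + mu_const T \<pi> \<epsilon>)"


section \<open>Robust problems\<close>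

text \<open>
  The uncertainty set \<open>\<Prod>\<^sub>\<alpha>\<^sub>\<in>\<^sub>I U\<^sub>\<alpha>\<close> is represented by the index set \<open>I\<close> together with its family of
  factors \<open>U\<close>.
\<close>

definition ro_feasible :: "'i set \<Rightarrow> ('i \<Rightarrow> ((real^'n::finite) \<times> real) set) \<Rightarrow> (real^'n) set" where
  "ro_feasible I U = {x. \<forall>\<alpha>\<in>I. \<forall>(a, b)\<in>U \<alpha>. a \<bullet> x \<ge> b}"

definition ro_value ::
    "(real^'n::finite) \<Rightarrow> 'i set \<Rightarrow> ('i \<Rightarrow> ((real^'n) \<times> real) set) \<Rightarrow> ereal" where
  "ro_value c I U = (INF x\<in>ro_feasible I U. ereal (c \<bullet> x))"

definition ro_opt ::
    "(real^'n::finite) \<Rightarrow> 'i set \<Rightarrow> ('i \<Rightarrow> ((real^'n) \<times> real) set) \<Rightarrow> (real^'n) set" where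
  "ro_opt c I U = {x \<in> ro_feasible I U. ereal (c \<bullet> x) = ro_value c I U}"

definition ro_strong_slater ::
    "'i set \<Rightarrow> ('i \<Rightarrow> ((real^'n::finite) \<times> real) set) \<Rightarrow> real \<Rightarrow> bool" where
  "ro_strong_slater I U \<rho> \<longleftrightarrow> (\<exists>x\<^sub>0. \<forall>\<alpha>\<in>I. \<forall>(a, b)\<in>U \<alpha>. a \<bullet> x\<^sub>0 \<ge> b + \<rho>)"

definition d_natural ::
    "'i set \<Rightarrow> ('i \<Rightarrow> ((real^'n::finite) \<times> real) set) \<Rightarrow> ('i \<Rightarrow> ((real^'n) \<times> real) set) \<Rightarrow> ennreal" where
  "d_natural I U V = (SUP \<alpha>\<in>I. hausdorff_edist (U \<alpha>) (V \<alpha>))"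

definition natural_index :: "'i set \<Rightarrow> ('i \<times> (real^'n::finite) \<times> real) set" where
  "natural_index I = I \<times> UNIV \<times> UNIV"

definition natural_system ::
    "'i set \<Rightarrow> ('i \<Rightarrow> ((real^'n::finite) \<times> real) set) \<Rightarrow> real
      \<Rightarrow> ('i \<times> (real^'n) \<times> real, 'n) lsio_system" where
  "natural_system I U \<rho> =
     (\<lambda>(\<alpha>, t, s)\<in>natural_index I. if (t, s) \<in> U \<alpha> then (t, s) else (0, - \<rho>))"

definition natural_problem ::
    "(real^'n::finite) \<Rightarrow> 'i set \<Rightarrow> ('i \<Rightarrow> ((real^'n) \<times> real) set) \<Rightarrow> real
      \<Rightarrow> ('i \<times> (real^'n) \<times> real, 'n) lsio_problem" where
  "natural_problem c I U \<rho> = (c, natural_system I U \<rho>)"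

end

theory Submission
  imports Defs
begin

text \<open>
  Write \<open>\<pi>\<close> for the semi-infinite problem of \<open>U\<close>, \<open>d < \<epsilon>\<close> for the distance between \<open>U\<close> and \<open>V\<close>,
  \<open>D\<close> for the distance from \<open>\<pi>\<close> to inconsistency, and \<open>z\<close> for the distance from \<open>0\<close> to the boundary
  of \<open>Z\<^sup>-\<close>. The estimate compares the robust problems of \<open>U\<close> and \<open>V\<close> directly: no constraint system
  is built for \<open>V\<close>, because every constraint of one problem lies within \<open>d\<close> of a constraint of the
  other one (\<open>exists_near_constraint\<close>), so that a feasible point \<open>x\<close> of one problem violates the
  constraints of the other by at most \<open>d sqrt (1 + \<parallel>x\<parallel>\<^sup>2)\<close>.

  Two distances make this quantitative. First, translating a system by a point of its
  hypographical set makes it inconsistent up to an arbitrarily small change, so that set keeps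
  distance \<open>D\<close> from the origin (\<open>dist_inconsistent_le_norm\<close>). Separation then yields a unit vector
  \<open>(u, w)\<close> with \<open>u \<bullet> a - w b \<ge> D\<close> for all constraints \<open>(a, b)\<close> of \<open>U\<close>, hence with margin at least
  \<open>D - \<epsilon>\<close> for those of \<open>V\<close>. Moving towards this direction repairs a violation \<open>k\<close> at the price of a
  displacement of at most \<open>k sqrt (1 + \<parallel>x\<parallel>\<^sup>2) / (D - \<epsilon>)\<close> (\<open>correct_infeasible_point\<close>). Altogether the
  cost changes by at most \<open>\<parallel>c\<parallel> (1 + \<parallel>x\<parallel>\<^sup>2) d / (D - \<epsilon>)\<close>. Secondly, \<open>Z\<^sup>-\<close> contains the ball of radius \<open>z\<close>
  around the origin, and every generator of \<open>Z\<^sup>-\<close> is bounded below on the points \<open>x\<close> that nearly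
  satisfy the constraints of \<open>U\<close> and cost at most the optimal value of \<open>U\<close>; this gives \<open>\<parallel>x\<parallel> \<le> \<mu>\<close>
  (\<open>norm_bound_of_ball_subset\<close>). As \<open>1 + \<mu>\<^sup>2 \<le> psi \<mu>\<close>, the constant \<open>L\<close> dominates what is needed in
  both directions. An optimal solution of \<open>U\<close> is repaired for \<open>V\<close>; conversely, the feasible points
  of \<open>V\<close> that are cheaper than the optimum of \<open>U\<close> are repaired for \<open>U\<close>.

  Both denominators are positive because \<open>D\<close> and \<open>z\<close> are at least the distance from \<open>\<pi>\<close> to the
  boundary of the solvable problems: within any larger distance there is an explicit unsolvable
  problem, and the segment from \<open>\<pi>\<close> to it meets that boundary
  (\<open>dist_frontier_le_outside_point\<close>). That \<open>\<pi>\<close> is an interior point follows from the same two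
  ingredients: the Slater point stays feasible under small perturbations, and the ball in \<open>Z\<^sup>-\<close> keeps
  its sublevel set compact (\<open>interior_solvable_of_slater\<close>).
\<close>

section \<open>Separation and correction of infeasible points\<close>

lemma exists_unit_supporting_direction:
  fixes S :: "'a::euclidean_space set"
  assumes "convex S" "z \<notin> interior S"
  obtains u where "norm u = 1" "\<And>y. y \<in> S \<Longrightarrow> u \<bullet> z \<le> u \<bullet> y"
proof -
  have "\<exists>v. v \<noteq> 0 \<and> (\<forall>y\<in>S. v \<bullet> z \<le> v \<bullet> y)"
  proof (cases "z \<in> S")
    case False
    then have "0 \<notin> (\<lambda>x. x - z) ` S" by auto
    then obtain v where "v \<noteq> 0" "\<forall>y\<in>(\<lambda>x. x - z) ` S. 0 \<le> v \<bullet> y"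
      using separating_hyperplane_set_0 convex_translation_subtract[OF assms(1)] by metis
    then show ?thesis by (auto simp: inner_diff_right)
  next
    case True
    show ?thesis
    proof (cases "interior S = {}")
      case True
      then obtain a b where "a \<noteq> 0" "S \<subseteq> {x. a \<bullet> x = b}"
        using empty_interior_subset_hyperplane assms(1) by blast
      moreover from this \<open>z \<in> S\<close> have "\<forall>y\<in>S. a \<bullet> y = a \<bullet> z" by blast
      ultimately show ?thesis by (intro exI[of _ a]) simp
    next
      case False
      then have "z \<notin> rel_interior S"
        using assms(2) by (simp add: rel_interior_nonempty_interior)
      moreover have "z \<in> closure S" using True closure_subset by blast
      ultimately obtain a where "a \<noteq> 0" "\<And>y. y \<in> closure S \<Longrightarrow> a \<bullet> z \<le> a \<bullet> y"
        using supporting_hyperplane_relative_frontier assms(1) by metis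
      then show ?thesis using closure_subset by blast
    qed
  qed
  then obtain v where v: "v \<noteq> 0" "\<forall>y\<in>S. v \<bullet> z \<le> v \<bullet> y" by blast
  show thesis
    by (rule that[of "v /\<^sub>R norm v"])
      (use v in \<open>auto simp: divide_right_mono inverse_eq_divide\<close>)
qed

lemma exists_unit_separating_direction:
  fixes S :: "'a::euclidean_space set"
  assumes "convex S" "S \<noteq> {}" "0 < D" "\<And>h. h \<in> S \<Longrightarrow> D \<le> norm h"
  obtains y where "norm y = 1" "\<And>h. h \<in> S \<Longrightarrow> D \<le> y \<bullet> h"
proof -
  let ?C = "closure S"
  let ?p = "closest_point ?C 0"
  have C: "convex ?C" "closed ?C" "?C \<noteq> {}"
    using assms(1,2) by (auto simp: convex_closure)
  have "?C \<subseteq> {h. D \<le> norm h}"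
    using assms(4) by (intro closure_minimal closed_Collect_le continuous_intros) auto
  moreover have "?p \<in> ?C" using C closest_point_in_set by blast
  ultimately have p: "D \<le> norm ?p" by blast
  have pos: "norm ?p > 0" using p \<open>0 < D\<close> by linarith
  have *: "norm ?p \<le> (?p /\<^sub>R norm ?p) \<bullet> h" if "h \<in> S" for h
  proof -
    have "(0 - ?p) \<bullet> (h - ?p) \<le> 0"
      using that closure_subset C by (intro closest_point_dot) auto
    then have "norm ?p * norm ?p \<le> ?p \<bullet> h"
      by (simp add: inner_diff_right flip: power2_eq_square power2_norm_eq_inner)
    then show ?thesis using pos by (simp add: field_simps)
  qed
  show thesis
    by (rule that[of "?p /\<^sub>R norm ?p"]) (use * p pos in \<open>auto intro: order_trans\<close>)
qed

text \<open>
  The set of points \<open>p - (0, s)\<close> with \<open>p\<close> in the convex hull of the constraints is the hypographical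
  set of the system, and its distance to the origin turns into a direction that every constraint
  shares. Since the set recedes along \<open>(0, -1)\<close>, the last coordinate of a separating vector cannot
  be positive, and it is written \<open>- w\<close>. For \<open>w > 0\<close> the point \<open>u / w\<close> is a strong Slater point, for
  \<open>w = 0\<close> the vector \<open>u\<close> is a direction along which every constraint improves; keeping the pair
  \<open>(u, w)\<close> treats both cases at once.
\<close>

lemma exists_slater_direction:
  fixes P :: "('a::euclidean_space \<times> real) set"
  assumes "P \<noteq> {}" "0 < D"
    and dist: "\<And>p s. p \<in> convex hull P \<Longrightarrow> 0 \<le> s \<Longrightarrow> D \<le> norm (p - (0, s))"
  obtains u :: 'a and w :: real where "norm (u, w) = 1" "0 \<le> w"
    "\<And>a b. (a, b) \<in> P \<Longrightarrow> D \<le> u \<bullet> a - w * b"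
proof -
  define R where "R = {0::'a} \<times> {0::real..}"
  define S where "S = (\<Union>p\<in>convex hull P. \<Union>q\<in>R. {p - q})"
  have "convex S"
    unfolding S_def R_def by (intro convex_differences convex_convex_hull convex_Times) auto
  moreover have "S \<noteq> {}"
  proof -
    obtain p where "p \<in> convex hull P" using assms(1) hull_subset[of P convex] by blast
    moreover have "0 \<in> R" by (simp add: R_def zero_prod_def)
    ultimately show ?thesis unfolding S_def by blast
  qed
  moreover have "D \<le> norm h" if "h \<in> S" for h
    using that dist unfolding S_def R_def by auto
  ultimately obtain y where y: "norm y = 1" "\<And>h. h \<in> S \<Longrightarrow> D \<le> y \<bullet> h"
    using exists_unit_separating_direction \<open>0 < D\<close> by metis
  obtain u v where uv: "y = (u, v)" by fastforce
  have *: "D \<le> u \<bullet> a + v * (b - s)" if "(a, b) \<in> P" "0 \<le> s" for a b s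
  proof -
    have "(a, b) - (0, s) \<in> S"
      using that hull_subset[of P convex] unfolding S_def R_def by blast
    from y(2)[OF this] show ?thesis by (simp add: uv)
  qed
  have "v \<le> 0"
  proof (rule ccontr)
    assume "\<not> v \<le> 0"
    then have "v > 0" by simp
    obtain a b where ab: "(a, b) \<in> P" using assms(1) by auto
    define s where "s = (\<bar>u \<bullet> a\<bar> + \<bar>v * b\<bar>) / v"
    have "v * s = \<bar>u \<bullet> a\<bar> + \<bar>v * b\<bar>" "0 \<le> s" using \<open>v > 0\<close> by (auto simp: s_def)
    then have "u \<bullet> a + v * (b - s) \<le> 0" by (simp add: right_diff_distrib)
    then show False using *[OF ab \<open>0 \<le> s\<close>] \<open>0 < D\<close> by linarith
  qed
  show thesis
  proof (rule that[of u "- v"])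
    show "norm (u, - v) = 1" using y(1) by (simp add: uv norm_Pair)
    show "0 \<le> - v" using \<open>v \<le> 0\<close> by simp
    show "D \<le> u \<bullet> a - - v * b" if "(a, b) \<in> P" for a b
      using *[OF that, of 0] by simp
  qed
qed

text \<open>
  Cauchy-Schwarz for the vector \<open>(x, -1)\<close>: the slack \<open>a \<bullet> x - b\<close> is a linear function of \<open>(a, b)\<close>
  with this gradient.
\<close>

lemma perturbed_slack:
  fixes a a' x :: "'a::real_inner"
  assumes "norm ((a, b) - (a', b')) \<le> d"
  shows "a' \<bullet> x - b' - d * sqrt (1 + (norm x)\<^sup>2) \<le> a \<bullet> x - b"
proof -
  have "((a', b') - (a, b)) \<bullet> (x, - 1 :: real) \<le> norm ((a', b') - (a, b)) * norm (x, - 1 :: real)"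
    by (rule norm_cauchy_schwarz)
  also have "\<dots> \<le> d * sqrt (1 + (norm x)\<^sup>2)"
  proof -
    have "norm (x, - 1 :: real) = sqrt (1 + (norm x)\<^sup>2)" by (simp add: norm_Pair add.commute)
    moreover have "norm ((a', b') - (a, b)) \<le> d" using assms by (metis norm_minus_commute)
    ultimately show ?thesis by (simp only: mult_right_mono real_sqrt_ge_zero add_nonneg_nonneg
          zero_le_one zero_le_power2)
  qed
  finally show ?thesis by (simp add: inner_diff_left)
qed

lemma sqrt_one_plus_square_le: "0 \<le> t \<Longrightarrow> sqrt (1 + t\<^sup>2) \<le> 1 + t"
  by (rule real_le_lsqrt) (auto simp: power2_eq_square algebra_simps)

text \<open>
  The corrected point is \<open>(D x + k u) / (D + k w)\<close>, a convex combination of \<open>x\<close> and the Slater point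
  \<open>u / w\<close> (or the translate \<open>x + (k / D) u\<close> if \<open>w = 0\<close>), with weights that make the violation \<open>k\<close> of
  the one and the margin \<open>D\<close> of the other cancel. The bound on the displacement is
  Cauchy-Schwarz again, applied to the unit vector \<open>(\<parallel>u\<parallel>, w)\<close> and \<open>(1, \<parallel>x\<parallel>)\<close>.
\<close>

lemma correct_infeasible_point:
  fixes u x :: "'a::real_inner"
  assumes uw: "norm (u, w) = 1" "0 \<le> w" and D: "0 < D" and k: "0 \<le> k"
    and margin: "\<And>a b. (a, b) \<in> Q \<Longrightarrow> D \<le> u \<bullet> a - w * b"
    and viol: "\<And>a b. (a, b) \<in> Q \<Longrightarrow> b - k \<le> a \<bullet> x"
  obtains y where "\<And>a b. (a, b) \<in> Q \<Longrightarrow> b \<le> a \<bullet> y"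
    "norm (y - x) \<le> k / D * sqrt (1 + (norm x)\<^sup>2)"
proof -
  let ?m = "D + k * w"
  have m: "D \<le> ?m" "0 < ?m" using assms by (auto simp: add_pos_nonneg)
  define y where "y = (D *\<^sub>R x + k *\<^sub>R u) /\<^sub>R ?m"
  have feas: "b \<le> a \<bullet> y" if "(a, b) \<in> Q" for a b
  proof -
    have "D * (b - k) + k * D \<le> D * (a \<bullet> x) + k * (u \<bullet> a - w * b)"
      using margin[OF that] viol[OF that] D k by (intro add_mono mult_left_mono) auto
    then have "b * ?m \<le> D * (a \<bullet> x) + k * (a \<bullet> u)"
      by (simp add: algebra_simps inner_commute)
    also have "\<dots> = (a \<bullet> y) * ?m"
    proof -
      have "a \<bullet> y = (D * (a \<bullet> x) + k * (a \<bullet> u)) / ?m"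
        by (simp add: y_def inner_add_right divide_inverse mult.commute)
      then show ?thesis using m by simp
    qed
    finally show ?thesis using m by simp
  qed
  have "y - x = (k *\<^sub>R (u - w *\<^sub>R x)) /\<^sub>R ?m"
  proof -
    have "D *\<^sub>R x + k *\<^sub>R u = ?m *\<^sub>R x + k *\<^sub>R (u - w *\<^sub>R x)"
      by (simp add: algebra_simps)
    then show ?thesis using m unfolding y_def by (simp add: scaleR_add_right)
  qed
  then have "norm (y - x) = k * norm (u - w *\<^sub>R x) / ?m"
    using m k by (simp add: divide_inverse abs_mult)
  also have "\<dots> \<le> k * sqrt (1 + (norm x)\<^sup>2) / D"
  proof (intro frac_le mult_left_mono)
    have "norm (u - w *\<^sub>R x) \<le> norm u + w * norm x"
      using norm_triangle_ineq4[of u "w *\<^sub>R x"] uw(2) by simp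
    also have "\<dots> = (norm u, w) \<bullet> (1, norm x)" by simp
    also have "\<dots> \<le> norm (norm u, w) * norm (1 :: real, norm x)" by (rule norm_cauchy_schwarz)
    also have "\<dots> = sqrt (1 + (norm x)\<^sup>2)" using uw(1) by (simp add: norm_Pair)
    finally show "norm (u - w *\<^sub>R x) \<le> sqrt (1 + (norm x)\<^sup>2)" .
  qed (use m D k in auto)
  finally show thesis using that[OF feas] by simp
qed

text \<open>
  The lower bound passes from \<open>A\<close> to its convex hull, where it is tested at vectors opposite to \<open>x\<close>.
\<close>

lemma norm_bound_of_ball_subset:
  fixes x :: "'a::real_inner"
  assumes ball: "ball 0 r \<subseteq> convex hull A" and A: "\<And>a. a \<in> A \<Longrightarrow> - K \<le> a \<bullet> x"
    and K: "0 \<le> K"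
  shows "r * norm x \<le> K"
proof (cases "x = 0")
  case False
  have hull: "- K \<le> a \<bullet> x" if "a \<in> convex hull A" for a
  proof -
    have "convex hull A \<subseteq> {a. - K \<le> x \<bullet> a}"
      using A by (intro hull_minimal convex_halfspace_ge) (auto simp: inner_commute)
    with that show ?thesis by (auto simp: inner_commute)
  qed
  have *: "s * norm x \<le> K" if s: "0 \<le> s" "s < r" for s
  proof -
    have "- (s / norm x) *\<^sub>R x \<in> ball 0 r" using s False by simp
    from hull[OF subsetD[OF ball this]] have "s / norm x * (norm x)\<^sup>2 \<le> K"
      by (simp add: power2_norm_eq_inner)
    then show ?thesis using False by (simp add: power2_eq_square)
  qed
  show ?thesis
  proof (cases "0 < r")
    case True
    have "r \<le> K / norm x"
      by (rule dense_le_bounded[OF True]) (use * False in \<open>auto simp: field_simps\<close>)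
    then show ?thesis using False by (simp add: field_simps)
  next
    case False
    then have "r * norm x \<le> 0" by (simp add: mult_nonpos_nonneg)
    then show ?thesis using K by linarith
  qed
qed (use K in simp)

section \<open>The distance between problems\<close>

lemma norm_edist_triangle: "norm_edist x z \<le> norm_edist x y + norm_edist y z"
  unfolding norm_edist_def
  by (metis ennreal_leI ennreal_plus norm_ge_zero dist_norm dist_triangle)

lemma delta_system_triangle:
  "delta_system T \<sigma> \<upsilon> \<le> delta_system T \<sigma> \<tau> + delta_system T \<tau> \<upsilon>"
  unfolding delta_system_def
proof (rule SUP_least)
  fix t assume "t \<in> T"
  then show "norm_edist (\<sigma> t) (\<upsilon> t)
      \<le> (SUP t\<in>T. norm_edist (\<sigma> t) (\<tau> t)) + (SUP t\<in>T. norm_edist (\<tau> t) (\<upsilon> t))"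
    by (intro order_trans[OF norm_edist_triangle[of _ _ "\<tau> t"]] add_mono SUP_upper)
qed

lemma delta_problem_triangle:
  "delta_problem T p r \<le> delta_problem T p q + delta_problem T q r"
  unfolding delta_problem_def
  by (intro max.boundedI order_trans[OF norm_edist_triangle[of _ _ "fst q"]]
      order_trans[OF delta_system_triangle[of _ _ _ "snd q"]] add_mono max.cobounded1 max.cobounded2)

lemma openin_delta_ball:
  "openin (problem_topology T) {q \<in> all_problems T. delta_problem T p q < r}"
  unfolding problem_topology_def openin_edist_topology
proof (intro conjI ballI)
  fix q assume "q \<in> {q \<in> all_problems T. delta_problem T p q < r}"
  then have q: "delta_problem T p q < r" by simp
  show "\<exists>s>0. \<forall>q'\<in>all_problems T. delta_problem T q q' < s \<longrightarrow>
      q' \<in> {q \<in> all_problems T. delta_problem T p q < r}"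
  proof (intro exI[of _ "r - delta_problem T p q"] conjI ballI impI CollectI)
    show "0 < r - delta_problem T p q" using q by (simp add: diff_gr0_ennreal)
    fix q' assume "delta_problem T q q' < r - delta_problem T p q"
    then have "delta_problem T q q' + delta_problem T p q < r"
      using q by (subst (asm) less_diff_eq_ennreal) (auto simp: less_top[symmetric] top_unique)
    then show "delta_problem T p q' < r"
      using delta_problem_triangle[of T p q' q] by (simp add: add.commute)
  qed
qed auto

lemma delta_problem_less_norms:
  assumes "delta_problem T p q < ennreal r"
  shows "norm (fst p - fst q) < r" "\<And>t. t \<in> T \<Longrightarrow> norm (snd p t - snd q t) < r"
proof -
  have "ennreal (norm (fst p - fst q)) < ennreal r"
    using assms unfolding delta_problem_def norm_edist_def by simp
  then show "norm (fst p - fst q) < r" by (simp add: ennreal_less_iff)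
  fix t assume "t \<in> T"
  then have "norm_edist (snd p t) (snd q t) \<le> delta_system T (snd p) (snd q)"
    unfolding delta_system_def by (rule SUP_upper)
  also have "\<dots> < ennreal r" using assms unfolding delta_problem_def by simp
  finally show "norm (snd p t - snd q t) < r"
    unfolding norm_edist_def by (simp add: ennreal_less_iff)
qed

definition segment_problem ::
    "'t set \<Rightarrow> ('t, 'n::finite) lsio_problem \<Rightarrow> ('t, 'n) lsio_problem \<Rightarrow> real \<Rightarrow> ('t, 'n) lsio_problem"
  where "segment_problem T p q s =
    (fst p + s *\<^sub>R (fst q - fst p), \<lambda>t\<in>T. snd p t + s *\<^sub>R (snd q t - snd p t))"

lemma segment_problem_in: "segment_problem T p q s \<in> all_problems T"
  by (auto simp: segment_problem_def all_problems_def all_systems_def)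

lemma segment_problem_0: "p \<in> all_problems T \<Longrightarrow> segment_problem T p q 0 = p"
  by (cases p) (auto simp: segment_problem_def all_problems_def all_systems_def
      PiE_def extensional_restrict)

lemma segment_problem_1: "q \<in> all_problems T \<Longrightarrow> segment_problem T p q 1 = q"
  by (cases q) (auto simp: segment_problem_def all_problems_def all_systems_def
      PiE_def extensional_restrict)

lemma delta_segment_problem_le:
  "delta_problem T (segment_problem T p q s) (segment_problem T p q s')
    \<le> ennreal \<bar>s - s'\<bar> * delta_problem T p q"
proof -
  have *: "norm_edist (x + s *\<^sub>R (y - x)) (x + s' *\<^sub>R (y - x)) = ennreal \<bar>s - s'\<bar> * norm_edist x y"
    for x y :: "'z::real_normed_vector"
  proof -
    have "(x + s *\<^sub>R (y - x)) - (x + s' *\<^sub>R (y - x)) = (s - s') *\<^sub>R (y - x)"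
      by (simp add: scaleR_left_diff_distrib)
    then show ?thesis
      unfolding norm_edist_def by (simp add: ennreal_mult norm_minus_commute)
  qed
  have "delta_system T (snd (segment_problem T p q s)) (snd (segment_problem T p q s'))
      \<le> ennreal \<bar>s - s'\<bar> * delta_system T (snd p) (snd q)"
    unfolding delta_system_def segment_problem_def
    by (rule SUP_least) (auto simp: * intro: mult_left_mono SUP_upper)
  moreover have "norm_edist (fst (segment_problem T p q s)) (fst (segment_problem T p q s'))
      \<le> ennreal \<bar>s - s'\<bar> * norm_edist (fst p) (fst q)"
    by (simp add: segment_problem_def *)
  ultimately show ?thesis
    unfolding delta_problem_def
    by (intro max.boundedI; elim order_trans; intro mult_left_mono) auto
qed

text \<open>
  A segment between two problems at finite distance is a path in the problem space, so it crosses
  the boundary of every set that contains one of its ends only.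
\<close>

lemma dist_frontier_le_outside_point:
  assumes p: "p \<in> all_problems T" "p \<in> S" and q: "q \<in> all_problems T" "q \<notin> S"
  shows "set_edist (delta_problem T) p (problem_topology T frontier_of S) \<le> delta_problem T p q"
proof (cases "delta_problem T p q = \<infinity>")
  case False
  then obtain r where r: "0 \<le> r" "delta_problem T p q = ennreal r"
    by (cases "delta_problem T p q") auto
  let ?seg = "segment_problem T p q"
  define G where "G = {s\<in>{0..1}. ?seg s \<in> S}"
  define m where "m = Sup G"
  have "0 \<in> G" using p by (simp add: G_def segment_problem_0)
  have bdd: "bdd_above G" by (rule bdd_aboveI[of _ 1]) (auto simp: G_def)
  have m01: "0 \<le> m" "m \<le> 1"
    unfolding m_def using \<open>0 \<in> G\<close> bdd
    by (auto intro: cSup_upper cSup_least simp: G_def)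
  have nbh: "\<exists>\<eta>>0. \<forall>s. \<bar>m - s\<bar> < \<eta> \<longrightarrow> ?seg s \<in> W"
    if W: "openin (problem_topology T) W" "?seg m \<in> W" for W
  proof -
    obtain e where "e > 0" and e: "\<forall>q'\<in>all_problems T. delta_problem T (?seg m) q' < e \<longrightarrow> q' \<in> W"
      using W unfolding problem_topology_def openin_edist_topology by meson
    obtain e' where e': "0 < e'" "e' < e" using \<open>e > 0\<close> dense by blast
    then obtain h where h: "e' = ennreal h" "0 < h"
      by (cases e') (auto simp: top_unique)
    show ?thesis
    proof (intro exI[of _ "h / (r + 1)"] conjI allI impI)
      show "0 < h / (r + 1)" using h r by simp
      fix s assume s: "\<bar>m - s\<bar> < h / (r + 1)"
      have "delta_problem T (?seg m) (?seg s) \<le> ennreal (\<bar>m - s\<bar> * r)"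
        using delta_segment_problem_le[of T p q m s] r by (simp add: ennreal_mult)
      also have "\<bar>m - s\<bar> * r \<le> \<bar>m - s\<bar> * (r + 1)" by (intro mult_left_mono) auto
      also have "\<dots> \<le> h" using s r by (simp add: field_simps)
      finally have "delta_problem T (?seg m) (?seg s) < e"
        using h e' by (metis ennreal_leI order_le_less_trans)
      then show "?seg s \<in> W" using e segment_problem_in by blast
    qed
  qed
  have "?seg m \<in> problem_topology T closure_of S"
    unfolding in_closure_of
  proof (intro conjI allI impI; (elim conjE)?)
    show "?seg m \<in> topspace (problem_topology T)"
      by (simp add: problem_topology_def segment_problem_in)
    fix W assume "?seg m \<in> W" "openin (problem_topology T) W"
    then obtain \<eta> where "\<eta> > 0" and eta: "\<forall>s. \<bar>m - s\<bar> < \<eta> \<longrightarrow> ?seg s \<in> W"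
      using nbh by meson
    obtain s where "s \<in> G" "m - \<eta> < s"
      using less_cSup_iff[of G "m - \<eta>"] \<open>0 \<in> G\<close> bdd \<open>\<eta> > 0\<close> unfolding m_def by auto
    moreover have "s \<le> m" unfolding m_def using \<open>s \<in> G\<close> bdd by (rule cSup_upper)
    ultimately show "\<exists>y. y \<in> S \<and> y \<in> W"
      using eta by (intro exI[of _ "?seg s"]) (auto simp: G_def)
  qed
  moreover have "?seg m \<notin> problem_topology T interior_of S"
  proof
    assume "?seg m \<in> problem_topology T interior_of S"
    then obtain W where W: "openin (problem_topology T) W" "?seg m \<in> W" "W \<subseteq> S"
      unfolding interior_of_def by blast
    then obtain \<eta> where "\<eta> > 0" and eta: "\<forall>s. \<bar>m - s\<bar> < \<eta> \<longrightarrow> ?seg s \<in> S"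
      using nbh[OF W(1,2)] W(3) by (meson subsetD)
    have "m \<noteq> 1" using eta[rule_format, of m] \<open>\<eta> > 0\<close> q(2) segment_problem_1[OF q(1), of p] by auto
    define s where "s = min 1 (m + \<eta> / 2)"
    have "s \<in> G" "m < s"
      using eta m01 \<open>m \<noteq> 1\<close> \<open>\<eta> > 0\<close> by (auto simp: G_def s_def min_def abs_if)
    then show False using cSup_upper[OF _ bdd, of s] by (simp add: m_def)
  qed
  ultimately have "?seg m \<in> problem_topology T frontier_of S" by (simp add: frontier_of_def)
  then have "set_edist (delta_problem T) p (problem_topology T frontier_of S)
      \<le> delta_problem T p (?seg m)"
    unfolding set_edist_def by (rule INF_lower)
  also have "\<dots> \<le> ennreal m * delta_problem T p q"
    using delta_segment_problem_le[of T p q 0 m] m01 p by (simp add: segment_problem_0)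
  also have "\<dots> \<le> 1 * delta_problem T p q"
    using m01 by (intro mult_right_mono) auto
  finally show ?thesis by simp
qed simp

section \<open>Distances to unsolvability and to inconsistency\<close>

lemma lsio_optI:
  assumes "x \<in> lsio_feasible T (snd \<pi>)"
    and "\<And>y. y \<in> lsio_feasible T (snd \<pi>) \<Longrightarrow> fst \<pi> \<bullet> x \<le> fst \<pi> \<bullet> y"
  shows "x \<in> lsio_opt T \<pi>"
  using assms unfolding lsio_opt_def lsio_value_def
  by (auto intro!: antisym INF_greatest INF_lower)

lemma lsio_opt_le:
  assumes "x \<in> lsio_opt T \<pi>" "y \<in> lsio_feasible T (snd \<pi>)"
  shows "fst \<pi> \<bullet> x \<le> fst \<pi> \<bullet> y"
proof -
  have "lsio_value T \<pi> \<le> ereal (fst \<pi> \<bullet> y)"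
    unfolding lsio_value_def using assms(2) by (rule INF_lower)
  then show ?thesis using assms(1) unfolding lsio_opt_def by (metis (lifting) ereal_less_eq(3) mem_Collect_eq)
qed

lemma Z_minus_generators:
  "t \<in> T \<Longrightarrow> fst (snd \<pi> t) \<in> Z_minus T \<pi>" "- fst \<pi> \<in> Z_minus T \<pi>"
  unfolding Z_minus_def by (blast intro: hull_inc)+

lemma convex_Z_minus: "convex (Z_minus T \<pi>)"
  unfolding Z_minus_def by (rule convex_convex_hull)

text \<open>
  If the origin were not interior, some direction \<open>u\<close> would be a recession direction of the
  feasible set along which the cost does not increase, and with every optimal solution the whole
  ray in direction \<open>u\<close> would be optimal.
\<close>

lemma zero_in_interior_Z_minus:
  assumes "lsio_opt T \<pi> \<noteq> {}" "bounded (lsio_opt T \<pi>)"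
  shows "0 \<in> interior (Z_minus T \<pi>)"
proof (rule ccontr)
  assume "0 \<notin> interior (Z_minus T \<pi>)"
  then obtain u where u: "norm u = 1" "\<And>y. y \<in> Z_minus T \<pi> \<Longrightarrow> u \<bullet> 0 \<le> u \<bullet> y"
    using exists_unit_supporting_direction convex_Z_minus by metis
  have a: "0 \<le> fst (snd \<pi> t) \<bullet> u" if "t \<in> T" for t
    using u(2)[OF Z_minus_generators(1)[OF that]] by (simp add: inner_commute)
  have c: "fst \<pi> \<bullet> u \<le> 0"
    using u(2)[OF Z_minus_generators(2)] by (simp add: inner_commute)
  obtain x where x: "x \<in> lsio_opt T \<pi>" using assms(1) by blast
  have ray: "x + s *\<^sub>R u \<in> lsio_opt T \<pi>" if "0 \<le> s" for s
  proof (rule lsio_optI)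
    show "x + s *\<^sub>R u \<in> lsio_feasible T (snd \<pi>)"
      using x a that unfolding lsio_opt_def lsio_feasible_def
      by (fastforce simp: inner_add_right intro: add_increasing2)
    fix y assume "y \<in> lsio_feasible T (snd \<pi>)"
    then have "fst \<pi> \<bullet> x \<le> fst \<pi> \<bullet> y" using x lsio_opt_le by blast
    moreover have "s * (fst \<pi> \<bullet> u) \<le> 0" using that c by (rule mult_nonneg_nonpos)
    ultimately show "fst \<pi> \<bullet> (x + s *\<^sub>R u) \<le> fst \<pi> \<bullet> y" by (simp add: inner_add_right)
  qed
  obtain B where B: "\<And>y. y \<in> lsio_opt T \<pi> \<Longrightarrow> norm y \<le> B"
    using assms(2) unfolding bounded_iff by blast
  define s where "s = B + norm x + 1"
  have "0 \<le> s" using B[OF x] norm_ge_zero[of x] unfolding s_def by linarith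
  have "s = norm (s *\<^sub>R u)" using u(1) \<open>0 \<le> s\<close> by simp
  also have "\<dots> \<le> norm (x + s *\<^sub>R u) + norm x"
    using norm_triangle_ineq4[of "x + s *\<^sub>R u" x] by simp
  also have "\<dots> \<le> B + norm x" using B[OF ray[OF \<open>0 \<le> s\<close>]] by simp
  finally show False by (simp add: s_def)
qed

text \<open>
  Subtracting a vector \<open>z'\<close> from every \<open>a\<^sub>t\<close> and adding it to the cost translates \<open>Z\<^sup>-\<close> by \<open>- z'\<close>.
  If \<open>z'\<close> lies just beyond a supporting hyperplane of \<open>Z\<^sup>-\<close> at a boundary point, the translated set
  stays on one side of the origin, so that the new problem has a feasible direction of strict
  descent and cannot have an optimal solution.
\<close>

lemma dist_frontier_le_dist_bd_Z:
  assumes "\<pi> \<in> solvable_problems T"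
  shows "set_edist (delta_problem T) \<pi> (problem_topology T frontier_of solvable_problems T)
    \<le> set_edist norm_edist 0 (frontier (Z_minus T \<pi>))"
  unfolding set_edist_def[of norm_edist]
proof (rule INF_greatest, rule ennreal_le_epsilon)
  fix z and e :: real
  assume z: "z \<in> frontier (Z_minus T \<pi>)" and e: "0 < e"
  then have "z \<notin> interior (Z_minus T \<pi>)" by (simp add: frontier_def)
  then obtain u where u: "norm u = 1" "\<And>y. y \<in> Z_minus T \<pi> \<Longrightarrow> u \<bullet> z \<le> u \<bullet> y"
    using exists_unit_supporting_direction convex_Z_minus by metis
  have uu: "u \<bullet> u = 1" using u(1) by (simp add: norm_eq_1)
  define z' where "z' = z - e *\<^sub>R u"
  define q where "q = (fst \<pi> + z', \<lambda>t\<in>T. snd \<pi> t - (z', 0))"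
  have q: "q \<in> all_problems T" by (auto simp: q_def all_problems_def all_systems_def)
  have a: "0 \<le> fst (snd q t) \<bullet> u" if "t \<in> T" for t
    using u(2)[OF Z_minus_generators(1)[OF that]] that e
    by (simp add: q_def z'_def inner_diff_left inner_diff_right inner_commute uu)
  have c: "fst q \<bullet> u < 0"
  proof -
    have "u \<bullet> fst q = u \<bullet> fst \<pi> + u \<bullet> z - e"
      by (simp add: q_def z'_def inner_diff_right inner_add_right uu)
    then show ?thesis
      using u(2)[OF Z_minus_generators(2)] e by (simp add: inner_commute[of "fst q"])
  qed
  have "lsio_opt T q = {}"
  proof (rule ccontr)
    assume "lsio_opt T q \<noteq> {}"
    then obtain x where x: "x \<in> lsio_opt T q" by blast
    then have "x + u \<in> lsio_feasible T (snd q)"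
      using a unfolding lsio_opt_def lsio_feasible_def
      by (fastforce simp: inner_add_right intro: add_increasing2)
    from lsio_opt_le[OF x this] show False using c by (simp add: inner_add_right)
  qed
  then have "q \<notin> solvable_problems T" by (simp add: solvable_problems_def)
  then have "set_edist (delta_problem T) \<pi> (problem_topology T frontier_of solvable_problems T)
      \<le> delta_problem T \<pi> q"
    using assms q by (intro dist_frontier_le_outside_point) (auto simp: solvable_problems_def)
  also have "\<dots> \<le> ennreal (norm z')"
    unfolding delta_problem_def delta_system_def
    by (intro max.boundedI SUP_least) (auto simp: q_def norm_edist_def norm_Pair)
  also have "\<dots> \<le> ennreal (norm z + e)"
    using norm_triangle_ineq4[of z "e *\<^sub>R u"] e u(1) by (intro ennreal_leI) (simp add: z'_def)
  also have "\<dots> = norm_edist 0 z + ennreal e" using e by (simp add: norm_edist_def)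
  finally show "set_edist (delta_problem T) \<pi> (problem_topology T frontier_of solvable_problems T)
      \<le> norm_edist 0 z + ennreal e" .
qed

lemma dist_frontier_le_dist_inconsistent:
  fixes \<pi> :: "('t, 'n::finite) lsio_problem"
  assumes "\<pi> \<in> solvable_problems T"
  shows "set_edist (delta_problem T) \<pi> (problem_topology T frontier_of solvable_problems T)
    \<le> set_edist (delta_system T) (snd \<pi>) (inconsistent_systems T)"
  unfolding set_edist_def[of "delta_system T"]
proof (rule INF_greatest)
  fix \<tau> :: "('t, 'n) lsio_system" assume \<tau>: "\<tau> \<in> inconsistent_systems T"
  have "(fst \<pi>, \<tau>) \<notin> solvable_problems T" "(fst \<pi>, \<tau>) \<in> all_problems T"
    using \<tau> by (auto simp: inconsistent_systems_def solvable_problems_def lsio_opt_def all_problems_def)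
  then have "set_edist (delta_problem T) \<pi> (problem_topology T frontier_of solvable_problems T)
      \<le> delta_problem T \<pi> (fst \<pi>, \<tau>)"
    using assms by (intro dist_frontier_le_outside_point) (auto simp: solvable_problems_def)
  also have "\<dots> = delta_system T (snd \<pi>) \<tau>"
    by (simp add: delta_problem_def norm_edist_def)
  finally show "set_edist (delta_problem T) \<pi> (problem_topology T frontier_of solvable_problems T)
      \<le> delta_system T (snd \<pi>) \<tau>" .
qed

text \<open>
  Translating the whole system by a point \<open>p - (0, s)\<close> of its hypographical set makes the constraint
  \<open>0 \<bullet> x \<ge> s\<close> a convex combination of the constraints, and an arbitrarily small further increase of
  the right-hand sides turns it into a contradiction.
\<close>

lemma dist_inconsistent_le_norm:
  assumes "\<sigma> \<in> all_systems T" "p \<in> convex hull (\<sigma> ` T)" "0 \<le> s"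
  shows "set_edist (delta_system T) \<sigma> (inconsistent_systems T) \<le> ennreal (norm (p - (0, s)))"
proof (rule ennreal_le_epsilon)
  fix e :: real assume e: "0 < e"
  obtain a b where p: "p = (a, b)" by fastforce
  define h where "h = p - (0, s) - (0, e)"
  define \<tau> where "\<tau> = (\<lambda>t\<in>T. \<sigma> t - h)"
  have False if x: "x \<in> lsio_feasible T \<tau>" for x
  proof -
    have "convex hull (\<sigma> ` T) \<subseteq> {q. (x, - 1 :: real) \<bullet> q \<ge> a \<bullet> x - b + s + e}"
    proof (intro hull_minimal convex_halfspace_ge subsetI)
      fix q assume "q \<in> \<sigma> ` T"
      then obtain t where "t \<in> T" "q = \<sigma> t" by blast
      then have "snd (q - h) \<le> fst (q - h) \<bullet> x"
        using x by (auto simp: lsio_feasible_def \<tau>_def)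
      then show "q \<in> {q. (x, - 1 :: real) \<bullet> q \<ge> a \<bullet> x - b + s + e}"
        by (cases q) (simp add: h_def p inner_diff_right inner_commute)
    qed
    then have "(x, - 1 :: real) \<bullet> p \<ge> a \<bullet> x - b + s + e" using assms(2) by blast
    then show False using e assms(3) by (simp add: p inner_commute)
  qed
  then have "\<tau> \<in> inconsistent_systems T"
    by (auto simp: inconsistent_systems_def all_systems_def \<tau>_def)
  then have "set_edist (delta_system T) \<sigma> (inconsistent_systems T) \<le> delta_system T \<sigma> \<tau>"
    unfolding set_edist_def by (rule INF_lower)
  also have "\<dots> \<le> ennreal (norm h)"
    unfolding delta_system_def by (rule SUP_least) (auto simp: \<tau>_def norm_edist_def)
  also have "\<dots> \<le> ennreal (norm (p - (0, s)) + e)"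
    using norm_triangle_ineq4[of "p - (0, s)" "(0, e)"] e
    by (intro ennreal_leI) (simp add: h_def norm_Pair)
  finally show "set_edist (delta_system T) \<sigma> (inconsistent_systems T)
      \<le> ennreal (norm (p - (0, s))) + ennreal e" using e by simp
qed

text \<open>
  A ball is connected, so one that misses the boundary of a set and meets the set lies inside it.
\<close>

lemma ball_subset_of_dist_frontier:
  fixes S :: "'a::real_normed_vector set"
  assumes "0 \<in> S" "ennreal r \<le> set_edist norm_edist 0 (frontier S)"
  shows "ball 0 r \<subseteq> S"
proof (rule ccontr)
  assume "\<not> ball 0 r \<subseteq> S"
  then have "ball 0 r - S \<noteq> {}" by blast
  moreover from this have "0 \<in> ball 0 r" by (metis Diff_eq_empty_iff ball_eq_empty centre_in_ball empty_subsetI not_le)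
  ultimately have "ball 0 r \<inter> frontier S \<noteq> {}"
    using assms(1) by (intro connected_Int_frontier connected_ball) blast+
  then obtain z where z: "norm z < r" "z \<in> frontier S" by auto
  then have "ennreal r \<le> norm_edist 0 z"
    using assms(2) unfolding set_edist_def by (meson INF_lower order_trans)
  then show False using z by (simp add: norm_edist_def ennreal_le_iff2)
qed

text \<open>
  Under a small perturbation the Slater point \<open>x\<^sub>0\<close> stays feasible. The ball around the origin in
  \<open>Z\<^sup>-\<close> makes the feasible points with cost at most that of \<open>x\<^sub>0\<close> a bounded set, so the minimum is
  attained there.
\<close>

lemma interior_solvable_of_slater:
  fixes \<pi> :: "('t, 'n::finite) lsio_problem"
  assumes \<pi>: "\<pi> \<in> all_problems T"
    and opt: "lsio_opt T \<pi> \<noteq> {}" "bounded (lsio_opt T \<pi>)"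
    and "0 < \<rho>" and slater: "\<And>t. t \<in> T \<Longrightarrow> snd (snd \<pi> t) + \<rho> \<le> fst (snd \<pi> t) \<bullet> x\<^sub>0"
    and rhs: "\<And>t. t \<in> T \<Longrightarrow> - snd (snd \<pi> t) \<le> K"
  shows "\<pi> \<in> problem_topology T interior_of solvable_problems T"
proof -
  obtain r\<^sub>0 where r\<^sub>0: "0 < r\<^sub>0" "ball 0 r\<^sub>0 \<subseteq> Z_minus T \<pi>"
    using zero_in_interior_Z_minus[OF opt] mem_interior by blast
  define S where "S = sqrt (1 + (norm x\<^sub>0)\<^sup>2)"
  have "0 < S" unfolding S_def by (simp add: add_pos_nonneg)
  define r where "r = min (\<rho> / S) (r\<^sub>0 / 2)"
  have r: "0 < r" "r * S \<le> \<rho>" "2 * r \<le> r\<^sub>0"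
    using \<open>0 < \<rho>\<close> \<open>0 < S\<close> r\<^sub>0 by (auto simp: r_def min_def field_simps)
  let ?W = "{q \<in> all_problems T. delta_problem T \<pi> q < ennreal r}"
  have "q \<in> solvable_problems T" if q: "q \<in> ?W" for q
  proof -
    let ?c = "fst q"
    have near_c: "norm (fst \<pi> - ?c) < r" and near: "\<And>t. t \<in> T \<Longrightarrow> norm (snd \<pi> t - snd q t) < r"
      using q delta_problem_less_norms[of T \<pi> q r] by auto
    have slack: "fst (snd q t) \<bullet> x - snd (snd q t) - r * sqrt (1 + (norm x)\<^sup>2)
        \<le> fst (snd \<pi> t) \<bullet> x - snd (snd \<pi> t)"
      and slack': "fst (snd \<pi> t) \<bullet> x - snd (snd \<pi> t) - r * sqrt (1 + (norm x)\<^sup>2)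
        \<le> fst (snd q t) \<bullet> x - snd (snd q t)" if "t \<in> T" for t x
      using near[OF that] by (auto intro!: perturbed_slack simp: norm_minus_commute)
    let ?C = "lsio_feasible T (snd q) \<inter> {x. ?c \<bullet> x \<le> ?c \<bullet> x\<^sub>0}"
    have "x\<^sub>0 \<in> ?C"
      using slater slack'[of _ x\<^sub>0] r(2) unfolding lsio_feasible_def S_def by fastforce
    have "closed ?C"
    proof -
      have "lsio_feasible T (snd q) = (\<Inter>t\<in>T. {x. snd (snd q t) \<le> fst (snd q t) \<bullet> x})"
        by (auto simp: lsio_feasible_def)
      then show ?thesis
        by (auto intro!: closed_Int closed_INT closed_halfspace_ge closed_halfspace_le)
    qed
    have "bounded ?C"
    proof -
      let ?K = "max K \<bar>?c \<bullet> x\<^sub>0\<bar>"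
      have "norm x \<le> (?K + r) / r" if x: "x \<in> ?C" for x
      proof -
        have "r\<^sub>0 * norm x \<le> ?K + r * (1 + norm x)"
        proof (rule norm_bound_of_ball_subset[OF r\<^sub>0(2)[unfolded Z_minus_def]])
          fix a assume "a \<in> (\<lambda>t. fst (snd \<pi> t)) ` T \<union> {- fst \<pi>}"
          then consider t where "t \<in> T" "a = fst (snd \<pi> t)" | "a = - fst \<pi>" by blast
          then show "- (?K + r * (1 + norm x)) \<le> a \<bullet> x"
          proof cases
            case 1
            have "r * sqrt (1 + (norm x)\<^sup>2) \<le> r * (1 + norm x)"
              using r by (intro mult_left_mono sqrt_one_plus_square_le) auto
            moreover have "snd (snd q t) \<le> fst (snd q t) \<bullet> x"
              using x 1 by (auto simp: lsio_feasible_def)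
            ultimately show ?thesis using slack[OF 1(1), of x] rhs[OF 1(1)]
            unfolding 1(2) by linarith
          next
            case 2
            have "(fst \<pi> - ?c) \<bullet> x \<le> r * norm x"
              using norm_cauchy_schwarz[of "fst \<pi> - ?c" x] near_c
              by (meson mult_right_mono norm_ge_zero order_less_imp_le order_trans)
            moreover have "?c \<bullet> x \<le> ?K" using x by auto
            ultimately show ?thesis using r 2 by (simp add: inner_diff_left distrib_left)
          qed
        qed (use r in auto)
        moreover have "2 * r * norm x \<le> r\<^sub>0 * norm x" using r by (intro mult_right_mono) auto
        ultimately have "r * norm x \<le> ?K + r" by (simp add: distrib_left)
        then show ?thesis using r by (simp add: field_simps)
      qed
      then show ?thesis unfolding bounded_iff by blast
    qed
    with \<open>closed ?C\<close> have "compact ?C" by (simp add: compact_eq_bounded_closed)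
    moreover have "continuous_on ?C (\<lambda>x. ?c \<bullet> x)" by (intro continuous_intros)
    ultimately obtain y where y: "y \<in> ?C" "\<And>x. x \<in> ?C \<Longrightarrow> ?c \<bullet> y \<le> ?c \<bullet> x"
      using continuous_attains_inf[of ?C] \<open>x\<^sub>0 \<in> ?C\<close> by blast
    have "y \<in> lsio_opt T q"
    proof (rule lsio_optI)
      show "y \<in> lsio_feasible T (snd q)" using y by blast
      fix x assume "x \<in> lsio_feasible T (snd q)"
      then show "?c \<bullet> y \<le> ?c \<bullet> x" using y(1) y(2)[of x] by (cases "?c \<bullet> x \<le> ?c \<bullet> x\<^sub>0") auto
    qed
    then show ?thesis using q by (auto simp: solvable_problems_def)
  qed
  then have "?W \<subseteq> problem_topology T interior_of solvable_problems T"
    by (intro interior_of_maximal openin_delta_ball) blast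
  moreover have "\<pi> \<in> ?W"
  proof -
    have "delta_problem T \<pi> \<pi> \<le> 0"
      unfolding delta_problem_def delta_system_def
      by (intro max.boundedI SUP_least) (auto simp: norm_edist_def)
    then show ?thesis using \<pi> r by simp
  qed
  ultimately show ?thesis by blast
qed

section \<open>Near-feasible points of a robust problem\<close>

lemma norm_edist_commute: "norm_edist x y = norm_edist y x"
  by (simp add: norm_edist_def norm_minus_commute)

lemma d_natural_commute: "d_natural I U V = d_natural I V U"
  unfolding d_natural_def hausdorff_edist_def by (simp add: norm_edist_commute max.commute)

text \<open>
  An empty \<open>D\<close> is at infinite distance from \<open>u\<close>, so finiteness of the distance provides a
  nearest point.
\<close>

lemma exists_near_point:
  fixes D :: "'a::euclidean_space set"
  assumes "hausdorff_edist C D \<le> ennreal d" "0 \<le> d" "compact D" "u \<in> C"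
  obtains v where "v \<in> D" "norm (u - v) \<le> d"
proof -
  have "(INF v\<in>D. norm_edist u v) \<le> (SUP u\<in>C. INF v\<in>D. norm_edist u v)"
    using assms(4) by (rule SUP_upper)
  also have "\<dots> \<le> ennreal d" using assms(1) unfolding hausdorff_edist_def by simp
  finally have inf: "(INF v\<in>D. norm_edist u v) \<le> ennreal d" .
  then have "D \<noteq> {}" by (auto simp: top_unique)
  then obtain v where v: "v \<in> D" "\<And>y. y \<in> D \<Longrightarrow> dist u v \<le> dist u y"
    using distance_attains_inf[of D u] compact_imp_closed[OF assms(3)] by metis
  have "ennreal (norm (u - v)) \<le> (INF v\<in>D. norm_edist u v)"
    unfolding norm_edist_def
    by (intro INF_greatest ennreal_leI) (use v in \<open>auto simp: dist_norm\<close>)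
  with inf have "ennreal (norm (u - v)) \<le> ennreal d" by order
  then have "norm (u - v) \<le> d" using assms(2) by simp
  with v(1) show thesis by (rule that)
qed

lemma exists_near_constraint:
  assumes "d_natural I U V \<le> ennreal d" "0 \<le> d" "\<alpha> \<in> I" "compact (V \<alpha>)" "(a, b) \<in> U \<alpha>"
  obtains a' b' where "(a', b') \<in> V \<alpha>" "norm ((a, b) - (a', b')) \<le> d"
proof -
  have "hausdorff_edist (U \<alpha>) (V \<alpha>) \<le> ennreal d"
    using assms(1,3) unfolding d_natural_def by (meson SUP_upper order_trans)
  from exists_near_point[OF this assms(2,4,5)] that show thesis by (metis prod.exhaust)
qed

lemma ro_feasible_near_violation:
  assumes "d_natural I U V \<le> ennreal d" "0 \<le> d" "\<And>\<alpha>. \<alpha> \<in> I \<Longrightarrow> compact (V \<alpha>)"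
    and "x \<in> ro_feasible I V" "\<alpha> \<in> I" "(a, b) \<in> U \<alpha>"
  shows "b - d * sqrt (1 + (norm x)\<^sup>2) \<le> a \<bullet> x"
proof -
  obtain a' b' where near: "(a', b') \<in> V \<alpha>" "norm ((a, b) - (a', b')) \<le> d"
    using exists_near_constraint[OF assms(1,2,5) assms(3)[OF assms(5)] assms(6)] .
  have "b' \<le> a' \<bullet> x" using assms(4,5) near(1) unfolding ro_feasible_def by blast
  with perturbed_slack[OF near(2), of x] show ?thesis by linarith
qed

lemma slater_direction_near:
  assumes "d_natural I U V \<le> ennreal d" "0 \<le> d" "\<And>\<alpha>. \<alpha> \<in> I \<Longrightarrow> compact (U \<alpha>)"
    and "norm (u, w) = 1"
    and margin: "\<And>\<alpha> a b. \<alpha> \<in> I \<Longrightarrow> (a, b) \<in> U \<alpha> \<Longrightarrow> D \<le> u \<bullet> a - w * b"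
    and "\<alpha> \<in> I" "(a, b) \<in> V \<alpha>"
  shows "D - d \<le> u \<bullet> a - w * b"
proof -
  obtain a' b' where near: "(a', b') \<in> U \<alpha>" "norm ((a, b) - (a', b')) \<le> d"
    using exists_near_constraint[OF assms(1)[unfolded d_natural_commute[of I U]] assms(2,6)
        assms(3)[OF assms(6)] assms(7)] .
  have "(u, - w) \<bullet> ((a', b') - (a, b)) \<le> norm (u, - w) * norm ((a', b') - (a, b))"
    by (rule norm_cauchy_schwarz)
  also have "\<dots> \<le> d"
  proof -
    have "norm (u, - w) = 1" using assms(4) by (simp add: norm_Pair)
    then show ?thesis using near(2) by (metis mult_1 norm_minus_commute)
  qed
  finally have "u \<bullet> a' - w * b' - d \<le> u \<bullet> a - w * b" by (simp add: inner_diff_right algebra_simps)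
  then show ?thesis using margin[OF assms(6) near(1)] by linarith
qed

lemma one_plus_square_le_psi:
  assumes "0 \<le> t" "t \<le> M"
  shows "1 + t\<^sup>2 \<le> psi M"
proof -
  have "1 + t\<^sup>2 \<le> 1 + M\<^sup>2" using assms by (intro add_left_mono power_mono)
  also have "\<dots> = sqrt (1 + M\<^sup>2) * sqrt (1 + M\<^sup>2)" by simp
  also have "\<dots> \<le> psi M"
    unfolding psi_def using assms by (intro mult_right_mono sqrt_one_plus_square_le) auto
  finally show ?thesis .
qed

text \<open>
  A point that violates the constraints of \<open>V\<close> by no more than a perturbation of size \<open>d\<close> can do is
  corrected at a cost linear in \<open>d\<close>: the violation contributes one factor \<open>sqrt (1 + \<parallel>x\<parallel>\<^sup>2)\<close> and the
  displacement the other, and their product is at most \<open>psi M\<close>.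
\<close>

lemma ro_value_le_of_near_feasible:
  fixes x :: "real^'n"
  assumes uw: "norm (u, w) = 1" "0 \<le> w" and D: "0 < D" and d: "0 \<le> d"
    and margin: "\<And>\<alpha> a b. \<alpha> \<in> I \<Longrightarrow> (a, b) \<in> V \<alpha> \<Longrightarrow> D \<le> u \<bullet> a - w * b"
    and viol: "\<And>\<alpha> a b. \<alpha> \<in> I \<Longrightarrow> (a, b) \<in> V \<alpha> \<Longrightarrow> b - d * sqrt (1 + (norm x)\<^sup>2) \<le> a \<bullet> x"
    and M: "norm x \<le> M"
  shows "ro_value c I V \<le> ereal (c \<bullet> x + norm c * psi M / D * d)"
proof -
  obtain y where feas: "\<And>a b. (a, b) \<in> (\<Union>\<alpha>\<in>I. V \<alpha>) \<Longrightarrow> b \<le> a \<bullet> y"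
    and y: "norm (y - x) \<le> d * sqrt (1 + (norm x)\<^sup>2) / D * sqrt (1 + (norm x)\<^sup>2)"
    by (rule correct_infeasible_point[OF uw D, of "d * sqrt (1 + (norm x)\<^sup>2)" "\<Union>\<alpha>\<in>I. V \<alpha>" x])
      (use margin viol d in auto)
  note y
  also have "d * sqrt (1 + (norm x)\<^sup>2) / D * sqrt (1 + (norm x)\<^sup>2) = d / D * (1 + (norm x)\<^sup>2)"
    by (simp add: add_nonneg_nonneg)
  also have "\<dots> \<le> d / D * psi M"
    using d D M by (intro mult_left_mono one_plus_square_le_psi) auto
  finally have "norm c * norm (y - x) \<le> norm c * (d / D * psi M)" by (rule mult_left_mono) simp
  then have "c \<bullet> (y - x) \<le> norm c * (d / D * psi M)"
    using norm_cauchy_schwarz[of c "y - x"] by linarith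
  then have "c \<bullet> y \<le> c \<bullet> x + norm c * psi M / D * d"
    by (simp add: inner_diff_right algebra_simps)
  moreover have "ro_value c I V \<le> ereal (c \<bullet> y)"
    unfolding ro_value_def using feas by (intro INF_lower) (auto simp: ro_feasible_def)
  ultimately show ?thesis by (meson ereal_less_eq(3) order_trans)
qed

text \<open>
  If \<open>z = \<infinity>\<close>, the bound holds with every \<open>r\<close> and forces \<open>x = 0\<close>, in accordance with the quotient
  \<open>N / \<infinity> = 0\<close>.
\<close>

lemma norm_le_ereal_quotient:
  fixes x :: "'a::real_normed_vector"
  assumes "0 < z" and bound: "\<And>r. ereal r \<le> z \<Longrightarrow> r * norm x \<le> N"
  shows "norm x \<le> real_of_ereal (ereal N / z)"
proof (cases z)
  case (real s)
  then show ?thesis using assms(1) bound[of s] by (simp add: field_simps)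
next
  case PInf
  have "norm x = 0"
  proof (rule ccontr)
    assume "norm x \<noteq> 0"
    then have "norm x > 0" by simp
    then have "(N + 1) / norm x * norm x \<le> N" using PInf by (intro bound) auto
    then show False using \<open>norm x > 0\<close> by simp
  qed
  then show ?thesis using PInf by simp
qed (use assms(1) in simp)

section \<open>The semi-infinite problem of a robust problem\<close>

lemma natural_problem_in: "natural_problem c I U \<rho> \<in> all_problems (natural_index I)"
  by (simp add: natural_problem_def all_problems_def all_systems_def natural_system_def)

lemma natural_system_cases:
  assumes "t \<in> natural_index I"
  obtains \<alpha> a b where "\<alpha> \<in> I" "(a, b) \<in> U \<alpha>" "natural_system I U \<rho> t = (a, b)"
  | "natural_system I U \<rho> t = (0, - \<rho>)"
proof -
  obtain \<alpha> a b where "t = (\<alpha>, a, b)" by (cases t)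
  with assms that show thesis
    by (cases "(a, b) \<in> U \<alpha>") (auto simp: natural_system_def natural_index_def)
qed

lemma natural_system_attains:
  assumes "\<alpha> \<in> I" "(a, b) \<in> U \<alpha>"
  shows "(a, b) \<in> natural_system I U \<rho> ` natural_index I"
  using assms by (intro image_eqI[of _ _ "(\<alpha>, a, b)"]) (auto simp: natural_system_def natural_index_def)

lemma natural_feasible:
  assumes "0 \<le> \<rho>"
  shows "lsio_feasible (natural_index I) (natural_system I U \<rho>) = ro_feasible I U"
proof (intro set_eqI iffI)
  fix x assume "x \<in> lsio_feasible (natural_index I) (natural_system I U \<rho>)"
  then have "\<forall>p\<in>natural_system I U \<rho> ` natural_index I. snd p \<le> fst p \<bullet> x"
    by (simp add: lsio_feasible_def)
  then have "b \<le> a \<bullet> x" if "\<alpha> \<in> I" "(a, b) \<in> U \<alpha>" for \<alpha> a b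
    using natural_system_attains[of \<alpha> I a b U \<rho>] that by (metis fst_conv snd_conv)
  then show "x \<in> ro_feasible I U" unfolding ro_feasible_def by blast
next
  fix x assume x: "x \<in> ro_feasible I U"
  have "snd (natural_system I U \<rho> t) \<le> fst (natural_system I U \<rho> t) \<bullet> x"
    if "t \<in> natural_index I" for t
    using that
  proof (cases rule: natural_system_cases[where U = U and \<rho> = \<rho>])
    case (1 \<alpha> a b)
    then show ?thesis using x by (auto simp: ro_feasible_def)
  next
    case 2
    then show ?thesis using assms by simp
  qed
  then show "x \<in> lsio_feasible (natural_index I) (natural_system I U \<rho>)"
    by (simp add: lsio_feasible_def)
qed

lemma natural_value:
  "0 \<le> \<rho> \<Longrightarrow> lsio_value (natural_index I) (natural_problem c I U \<rho>) = ro_value c I U"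
  by (simp add: lsio_value_def ro_value_def natural_problem_def natural_feasible)

lemma natural_opt:
  "0 \<le> \<rho> \<Longrightarrow> lsio_opt (natural_index I) (natural_problem c I U \<rho>) = ro_opt c I U"
  by (simp add: lsio_opt_def ro_opt_def natural_value) (simp add: natural_problem_def natural_feasible)

text \<open>
  Without constraints a linear cost has an optimal solution only if it vanishes, and then the
  whole space is optimal.
\<close>

lemma index_nonempty_of_bounded_opt:
  fixes c :: "real^'n"
  assumes "ro_opt c I U \<noteq> {}" "bounded (ro_opt c I U)"
  shows "I \<noteq> {}"
proof
  assume "I = {}"
  obtain x where x: "ereal (c \<bullet> x) = ro_value c I U" using assms(1) by (auto simp: ro_opt_def)
  have le: "c \<bullet> x \<le> c \<bullet> y" for y
  proof -
    have "ro_value c I U \<le> ereal (c \<bullet> y)"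
      unfolding ro_value_def by (rule INF_lower) (simp add: \<open>I = {}\<close> ro_feasible_def)
    then show ?thesis using x by (metis ereal_less_eq(3))
  qed
  have "c \<bullet> c \<le> 0" using le[of "x - c"] by (simp add: inner_diff_right)
  then have "c = 0" by (metis inner_eq_zero_iff inner_ge_zero order_antisym)
  then have "ro_opt c I U = UNIV"
    using x by (auto simp: ro_opt_def ro_feasible_def \<open>I = {}\<close>)
  then show False using assms(2) not_bounded_UNIV by metis
qed

text \<open>
  A compact \<open>U \<alpha>\<close> is not the whole space, so some index carries the constraint \<open>0 \<bullet> x \<ge> - \<rho>\<close>. This is
  what makes \<open>sup R\<close> positive.
\<close>

lemma natural_system_attains_default:
  fixes U :: "'i \<Rightarrow> ((real^'n) \<times> real) set"
  assumes "\<alpha> \<in> I" "compact (U \<alpha>)"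
  shows "(0, - \<rho>) \<in> natural_system I U \<rho> ` natural_index I"
proof -
  have "U \<alpha> \<noteq> UNIV" using assms(2) compact_imp_bounded not_bounded_UNIV by metis
  then obtain t s where "(t, s) \<notin> U \<alpha>" by auto
  then show ?thesis
    using assms(1)
    by (intro image_eqI[of _ _ "(\<alpha>, t, s)"]) (auto simp: natural_system_def natural_index_def)
qed

section \<open>The Lipschitz estimate for the optimal value\<close>

theorem theorem5p2:
  fixes I :: "'i set"
    and c :: "real^'n::finite"
    and U :: "'i \<Rightarrow> ((real^'n) \<times> real) set"
    and \<rho> :: real
  assumes U: "\<And>\<alpha>. \<alpha> \<in> I \<Longrightarrow> U \<alpha> \<noteq> {} \<and> compact (U \<alpha>) \<and> convex (U \<alpha>)"
    and rho_pos: "\<rho> > 0"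
    and slater: "ro_strong_slater I U \<rho>"
    and opt: "ro_opt c I U \<noteq> {}" "bounded (ro_opt c I U)"
    and bounded_rhs: "(SUP (a, b)\<in>(\<Union>\<alpha>\<in>I. U \<alpha>). ereal (- b)) < \<infinity>"
  shows "natural_problem c I U \<rho> \<in>
           problem_topology (natural_index I) interior_of solvable_problems (natural_index I) \<and>
         (\<forall>\<epsilon>::real. 0 < \<epsilon> \<longrightarrow>
            ennreal \<epsilon> < set_edist (delta_problem (natural_index I)) (natural_problem c I U \<rho>)
              (problem_topology (natural_index I) frontier_of solvable_problems (natural_index I)) \<longrightarrow>
            (\<forall>V :: 'i \<Rightarrow> ((real^'n) \<times> real) set.
               (\<forall>\<alpha>\<in>I. compact (V \<alpha>) \<and> convex (V \<alpha>)) \<longrightarrow>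
               d_natural I U V < ennreal \<epsilon> \<longrightarrow>
               \<bar>ro_value c I U - ro_value c I V\<bar> \<le>
                 ereal (lipschitz_const (natural_index I) (natural_problem c I U \<rho>) \<epsilon>)
                   * enn2ereal (d_natural I U V)))"
proof -
  let ?T = "natural_index I" and ?\<sigma> = "natural_system I U \<rho>" and ?\<pi> = "natural_problem c I U \<rho>"
  have fst\<pi>: "fst ?\<pi> = c" and snd\<pi>: "snd ?\<pi> = ?\<sigma>" by (simp_all add: natural_problem_def)
  have lopt: "lsio_opt ?T ?\<pi> \<noteq> {}" "bounded (lsio_opt ?T ?\<pi>)"
    using opt rho_pos by (simp_all add: natural_opt)
  obtain xs where xs: "xs \<in> ro_feasible I U" "ereal (c \<bullet> xs) = ro_value c I U"
    using opt(1) by (auto simp: ro_opt_def)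
  define \<nu> where "\<nu> = c \<bullet> xs"
  have val: "ro_value c I U = ereal \<nu>" using xs by (simp add: \<nu>_def)
  obtain \<alpha>\<^sub>0 where "\<alpha>\<^sub>0 \<in> I" using index_nonempty_of_bounded_opt[OF opt] by blast
  have slack_constraint: "(0, - \<rho>) \<in> ?\<sigma> ` ?T"
    using natural_system_attains_default[of \<alpha>\<^sub>0 I U \<rho>] \<open>\<alpha>\<^sub>0 \<in> I\<close> U by simp
  obtain t\<^sub>0 where t\<^sub>0: "t\<^sub>0 \<in> ?T" "?\<sigma> t\<^sub>0 = (0, - \<rho>)"
    using slack_constraint by (metis imageE)

  have R_top: "Sup (R_set ?T ?\<pi>) < \<infinity>"
  proof -
    let ?B = "SUP (a, b)\<in>(\<Union>\<alpha>\<in>I. U \<alpha>). ereal (- b)"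
    have "Sup (R_set ?T ?\<pi>) \<le> max ?B (max (ereal \<rho>) (ereal \<nu>))"
    proof (rule Sup_least)
      fix z assume "z \<in> R_set ?T ?\<pi>"
      then consider t where "t \<in> ?T" "z = ereal (- snd (?\<sigma> t))" | "z = ereal \<nu>"
        using rho_pos by (auto simp: R_set_def snd\<pi> natural_value val)
      then show "z \<le> max ?B (max (ereal \<rho>) (ereal \<nu>))"
      proof cases
        case (1 t)
        from 1(1) show ?thesis
        proof (cases rule: natural_system_cases[where U = U and \<rho> = \<rho>])
          case t: (1 \<alpha> a b)
          then have "ereal (- b) \<le> ?B" by (intro SUP_upper2[of "(a, b)"]) auto
          then show ?thesis using 1(2) t(3) by (simp add: le_max_iff_disj)
        next
          case 2
          then show ?thesis using 1(2) by (simp add: le_max_iff_disj)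
        qed
      qed (simp add: le_max_iff_disj)
    qed
    also have "\<dots> < \<infinity>" unfolding max_less_iff_conj using bounded_rhs by simp
    finally show ?thesis .
  qed
  have R_pos: "ereal \<rho> \<le> Sup (R_set ?T ?\<pi>)"
    unfolding R_set_def snd\<pi> using t\<^sub>0
    by (intro Sup_upper UnI1 image_eqI[of _ _ t\<^sub>0]) simp_all
  define K where "K = real_of_ereal (Sup (R_set ?T ?\<pi>))"
  have K: "Sup (R_set ?T ?\<pi>) = ereal K"
    using R_top R_pos unfolding K_def by (cases "Sup (R_set ?T ?\<pi>)") auto
  have "0 < K" using R_pos rho_pos by (simp add: K)
  have rhs: "- snd (?\<sigma> t) \<le> K" if "t \<in> ?T" for t
  proof -
    have "ereal (- snd (?\<sigma> t)) \<le> Sup (R_set ?T ?\<pi>)"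
      using that by (intro Sup_upper) (auto simp: R_set_def snd\<pi>)
    then show ?thesis by (simp add: K)
  qed
  have "\<nu> \<le> K"
  proof -
    have "ereal \<nu> \<le> Sup (R_set ?T ?\<pi>)"
      using rho_pos by (intro Sup_upper) (auto simp: R_set_def natural_value val)
    then show ?thesis by (simp add: K)
  qed

  obtain x\<^sub>0 where x\<^sub>0: "\<And>\<alpha> a b. \<alpha> \<in> I \<Longrightarrow> (a, b) \<in> U \<alpha> \<Longrightarrow> b + \<rho> \<le> a \<bullet> x\<^sub>0"
    using slater unfolding ro_strong_slater_def by blast
  have "snd (?\<sigma> t) + \<rho> \<le> fst (?\<sigma> t) \<bullet> x\<^sub>0" if "t \<in> ?T" for t
    using that by (cases rule: natural_system_cases[where U = U and \<rho> = \<rho>]) (auto simp: x\<^sub>0)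
  then have interior: "?\<pi> \<in> problem_topology ?T interior_of solvable_problems ?T"
    using rhs by (intro interior_solvable_of_slater[OF natural_problem_in lopt rho_pos])
      (auto simp: snd\<pi>)
  have solvable: "?\<pi> \<in> solvable_problems ?T"
    using lopt natural_problem_in by (simp add: solvable_problems_def)

  have estimate: "\<bar>ro_value c I U - ro_value c I V\<bar> \<le>
      ereal (lipschitz_const ?T ?\<pi> \<epsilon>) * enn2ereal (d_natural I U V)"
    if \<epsilon>: "0 < \<epsilon>" "ennreal \<epsilon> < set_edist (delta_problem ?T) ?\<pi>
              (problem_topology ?T frontier_of solvable_problems ?T)"
      and V: "\<And>\<alpha>. \<alpha> \<in> I \<Longrightarrow> compact (V \<alpha>)" and near: "d_natural I U V < ennreal \<epsilon>"
    for \<epsilon> :: real and V :: "'i \<Rightarrow> ((real^'n) \<times> real) set"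
  proof -
    obtain d where d: "0 \<le> d" "d_natural I U V = ennreal d"
      using near by (cases "d_natural I U V") auto
    have "d < \<epsilon>" using near d by (simp add: ennreal_less_iff)
    have dUV: "d_natural I U V \<le> ennreal d" "d_natural I V U \<le> ennreal d"
      using d by (simp_all add: d_natural_commute)

    define D where "D = real_of_ereal (dist_inconsistent ?T ?\<pi>)"
    have sys: "?\<sigma> \<in> all_systems ?T" by (simp add: all_systems_def natural_system_def)
    have D_le: "dist_inconsistent ?T ?\<pi> \<le> ereal (norm (p - (0, s)))"
      if "p \<in> convex hull (?\<sigma> ` ?T)" "0 \<le> s" for p s
      using dist_inconsistent_le_norm[OF sys that]
      by (metis dist_inconsistent_def snd\<pi> enn2ereal_ennreal less_eq_ennreal.rep_eq norm_ge_zero)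
    have "(0, - \<rho>) \<in> convex hull (?\<sigma> ` ?T)" using slack_constraint by (rule hull_inc)
    from D_le[OF this order_refl] have D_top: "dist_inconsistent ?T ?\<pi> < \<infinity>"
      by (rule order_le_less_trans) simp
    have "ennreal \<epsilon> < set_edist (delta_system ?T) ?\<sigma> (inconsistent_systems ?T)"
      using \<epsilon>(2) dist_frontier_le_dist_inconsistent[OF solvable] by (simp add: snd\<pi>)
    then have "ereal \<epsilon> < dist_inconsistent ?T ?\<pi>"
      using \<epsilon>(1) unfolding dist_inconsistent_def snd\<pi>
      by (metis enn2ereal_ennreal less_ennreal.rep_eq less_imp_le)
    then have D: "dist_inconsistent ?T ?\<pi> = ereal D" "\<epsilon> < D"
      using D_top unfolding D_def by (cases "dist_inconsistent ?T ?\<pi>"; simp)+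
    have "0 < D" "0 < D - \<epsilon>" using D(2) \<epsilon>(1) by simp_all
    obtain u w where uw: "norm (u, w) = 1" "0 \<le> w"
      and margin: "\<And>a b. (a, b) \<in> ?\<sigma> ` ?T \<Longrightarrow> D \<le> u \<bullet> a - w * b"
    proof (rule exists_slater_direction[of "?\<sigma> ` ?T" D])
      show "?\<sigma> ` ?T \<noteq> {}" using slack_constraint by blast
      show "D \<le> norm (p - (0, s))" if "p \<in> convex hull (?\<sigma> ` ?T)" "0 \<le> s" for p s
        using D_le[OF that] by (simp add: D(1))
    qed (use \<open>0 < D\<close> in auto)
    have margin_U: "D \<le> u \<bullet> a - w * b" if "\<alpha> \<in> I" "(a, b) \<in> U \<alpha>" for \<alpha> a b
      using natural_system_attains[of \<alpha> I a b U \<rho>] that by (simp add: margin)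

    define \<mu> where "\<mu> = mu_const ?T ?\<pi> \<epsilon>"
    define z where "z = dist_bd_Z ?T ?\<pi>"
    have "ennreal \<epsilon> < set_edist norm_edist 0 (frontier (Z_minus ?T ?\<pi>))"
      using \<epsilon>(2) dist_frontier_le_dist_bd_Z[OF solvable] by simp
    then have z: "ereal \<epsilon> < z"
      using \<epsilon>(1) unfolding z_def dist_bd_Z_def
      by (metis enn2ereal_ennreal less_ennreal.rep_eq less_imp_le)
    have ball: "ball 0 r \<subseteq> Z_minus ?T ?\<pi>" if "ereal r \<le> z" for r
    proof (cases "0 \<le> r")
      case True
      then have "ennreal r \<le> set_edist norm_edist 0 (frontier (Z_minus ?T ?\<pi>))"
        using that unfolding z_def dist_bd_Z_def by (simp add: less_eq_ennreal.rep_eq)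
      moreover have "0 \<in> Z_minus ?T ?\<pi>"
        using zero_in_interior_Z_minus[OF lopt] interior_subset by blast
      ultimately show ?thesis by (rule ball_subset_of_dist_frontier[rotated])
    qed (simp add: ball_empty)
    (* N is the numerator of mu; since gamma only enters through max 1 gamma, it exceeds
       sup R by at least \<epsilon>. *)
    define N where "N = K + \<epsilon> * max 1 (gamma_const ?T ?\<pi> \<epsilon>)"
    have N: "K + d \<le> N"
    proof -
      have "d * 1 \<le> \<epsilon> * max 1 (gamma_const ?T ?\<pi> \<epsilon>)"
        using \<open>d < \<epsilon>\<close> d(1) by (intro mult_mono) auto
      then show ?thesis by (simp add: N_def)
    qed
    have norm_le: "norm x \<le> \<mu>"
      if x: "\<And>\<alpha> a b. \<alpha> \<in> I \<Longrightarrow> (a, b) \<in> U \<alpha> \<Longrightarrow> b - d * sqrt (1 + (norm x)\<^sup>2) \<le> a \<bullet> x"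
        and cx: "c \<bullet> x \<le> \<nu>" for x
    proof -
      have gen: "- (K + d * (1 + norm x)) \<le> a \<bullet> x"
        if a: "a \<in> (\<lambda>t. fst (snd ?\<pi> t)) ` ?T \<union> {- fst ?\<pi>}" for a
      proof -
        have dx: "0 \<le> d * sqrt (1 + (norm x)\<^sup>2)" "d * sqrt (1 + (norm x)\<^sup>2) \<le> d * (1 + norm x)"
          using d(1) mult_left_mono[OF sqrt_one_plus_square_le[OF norm_ge_zero] d(1)] by simp_all
        consider t where "t \<in> ?T" "a = fst (?\<sigma> t)" | "a = - c"
          using a unfolding fst\<pi> snd\<pi> by blast
        then show ?thesis
        proof cases
          case (1 t)
          have "snd (?\<sigma> t) - d * sqrt (1 + (norm x)\<^sup>2) \<le> fst (?\<sigma> t) \<bullet> x"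
            using 1(1)
          proof (cases rule: natural_system_cases[where U = U and \<rho> = \<rho>])
            case t: (1 \<alpha> a' b)
            then show ?thesis using x by simp
          next
            case 2
            then show ?thesis using rho_pos dx(1) by simp
          qed
          then show ?thesis using rhs[OF 1(1)] dx unfolding 1(2) by linarith
        next
          case 2
          then show ?thesis using cx \<open>\<nu> \<le> K\<close> dx by simp
        qed
      qed
      have "norm x \<le> real_of_ereal (ereal N / (z - ereal \<epsilon>))"
        (* A ball of radius r + \<epsilon> is available in Z: the extra \<epsilon> absorbs the term d * norm x that
           the perturbation adds on the right-hand side. *)
      proof (rule norm_le_ereal_quotient)
        show "0 < z - ereal \<epsilon>" using z by (simp add: ereal_diff_gr0)
        fix r assume "ereal r \<le> z - ereal \<epsilon>"
        then have "ereal (r + \<epsilon>) \<le> z" by (cases z) auto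
        from norm_bound_of_ball_subset[OF ball[OF this, unfolded Z_minus_def] gen]
        have "(r + \<epsilon>) * norm x \<le> K + d * (1 + norm x)"
          using \<open>0 < K\<close> d(1) by simp
        moreover have "d * norm x \<le> \<epsilon> * norm x"
          using \<open>d < \<epsilon>\<close> by (intro mult_right_mono) auto
        ultimately show "r * norm x \<le> N" using N by (simp add: algebra_simps)
      qed
      then show ?thesis by (simp add: \<mu>_def mu_const_def K N_def z_def phi_def)
    qed

    define L where "L = norm c * psi \<mu> / (D - \<epsilon>)"
    have xs_le: "norm xs \<le> \<mu>"
    proof (rule norm_le)
      fix \<alpha> a b assume "\<alpha> \<in> I" "(a, b) \<in> U \<alpha>"
      then have "b \<le> a \<bullet> xs" using xs(1) unfolding ro_feasible_def by blast
      moreover have "0 \<le> d * sqrt (1 + (norm xs)\<^sup>2)" using d(1) by simp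
      ultimately show "b - d * sqrt (1 + (norm xs)\<^sup>2) \<le> a \<bullet> xs" by linarith
    qed (simp add: \<nu>_def)
    then have "0 \<le> \<mu>" using norm_ge_zero order_trans by blast
    then have "0 \<le> psi \<mu>" by (simp add: psi_def)
    have L_le: "L \<le> lipschitz_const ?T ?\<pi> \<epsilon>"
    proof -
      have "norm c * (psi \<mu> / (D - \<epsilon>)) \<le> (\<epsilon> + norm c) * (psi \<mu> / (D - \<epsilon>))"
        using \<epsilon>(1) \<open>0 \<le> psi \<mu>\<close> \<open>0 < D - \<epsilon>\<close> by (intro mult_right_mono) simp_all
      moreover have "lipschitz_const ?T ?\<pi> \<epsilon> = (\<epsilon> + norm c) * (psi \<mu> / (D - \<epsilon>)) + \<mu>"
        using \<open>0 < D - \<epsilon>\<close> by (simp add: lipschitz_const_def phi_def \<mu>_def D(1) fst\<pi>)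
      ultimately show ?thesis using \<open>0 \<le> \<mu>\<close> by (simp add: L_def)
    qed

    have upper: "ro_value c I V \<le> ereal (\<nu> + L * d)"
      unfolding L_def \<nu>_def
    proof (rule ro_value_le_of_near_feasible[OF uw \<open>0 < D - \<epsilon>\<close> d(1) _ _ xs_le])
      fix \<alpha> a b assume v: "\<alpha> \<in> I" "(a, b) \<in> V \<alpha>"
      have "D - d \<le> u \<bullet> a - w * b"
        by (rule slater_direction_near[OF dUV(1) d(1) _ uw(1) margin_U v]) (use U in auto)
      then show "D - \<epsilon> \<le> u \<bullet> a - w * b" using \<open>d < \<epsilon>\<close> by linarith
      show "b - d * sqrt (1 + (norm xs)\<^sup>2) \<le> a \<bullet> xs"
        by (rule ro_feasible_near_violation[OF dUV(2) d(1) _ xs(1) v]) (use U in auto)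
    qed
    have lower: "ereal (\<nu> - L * d) \<le> ro_value c I V"
      unfolding ro_value_def
    proof (rule INF_greatest)
      fix x assume x: "x \<in> ro_feasible I V"
      have "\<nu> \<le> c \<bullet> x + L * d"
        (* Only points at least as cheap as the optimum of U need an argument, and for those the
           optimal value itself supplies the bound on the generator - c of Z. *)
      proof (cases "c \<bullet> x \<le> \<nu>")
        case True
        have viol: "b - d * sqrt (1 + (norm x)\<^sup>2) \<le> a \<bullet> x" if "\<alpha> \<in> I" "(a, b) \<in> U \<alpha>" for \<alpha> a b
          using V by (rule ro_feasible_near_violation[OF dUV(1) d(1) _ x that])
        have "norm x \<le> \<mu>" using viol True by (rule norm_le)
        have "ro_value c I U \<le> ereal (c \<bullet> x + L * d)"
          unfolding L_def
        proof (rule ro_value_le_of_near_feasible[OF uw \<open>0 < D - \<epsilon>\<close> d(1) _ _ \<open>norm x \<le> \<mu>\<close>])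
          fix \<alpha> a b assume "\<alpha> \<in> I" "(a, b) \<in> U \<alpha>"
          then show "D - \<epsilon> \<le> u \<bullet> a - w * b" "b - d * sqrt (1 + (norm x)\<^sup>2) \<le> a \<bullet> x"
            using margin_U[of \<alpha> a b] viol[of \<alpha> a b] \<epsilon>(1) by simp_all
        qed
        then show ?thesis by (simp add: val)
      next
        case False
        moreover have "0 \<le> L * d"
          using \<open>0 \<le> psi \<mu>\<close> \<open>0 < D - \<epsilon>\<close> d(1) by (simp add: L_def)
        ultimately show ?thesis by linarith
      qed
      then show "ereal (\<nu> - L * d) \<le> ereal (c \<bullet> x)" by simp
    qed
    obtain \<nu>' where \<nu>': "ro_value c I V = ereal \<nu>'"
      using upper lower by (cases "ro_value c I V") auto
    have "\<bar>\<nu> - \<nu>'\<bar> \<le> L * d" using upper lower by (simp add: \<nu>' abs_le_iff)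
    also have "\<dots> \<le> lipschitz_const ?T ?\<pi> \<epsilon> * d" using L_le d(1) by (rule mult_right_mono)
    finally show ?thesis by (simp add: val \<nu>' d)
  qed
  show ?thesis
  proof (intro conjI interior allI impI)
    fix \<epsilon> :: real and V :: "'i \<Rightarrow> ((real^'n) \<times> real) set"
    assume "0 < \<epsilon>" "ennreal \<epsilon> < set_edist (delta_problem ?T) ?\<pi>
        (problem_topology ?T frontier_of solvable_problems ?T)"
      and V: "\<forall>\<alpha>\<in>I. compact (V \<alpha>) \<and> convex (V \<alpha>)" and "d_natural I U V < ennreal \<epsilon>"
    moreover have "compact (V \<alpha>)" if "\<alpha> \<in> I" for \<alpha> using V that by blast
    ultimately show "\<bar>ro_value c I U - ro_value c I V\<bar> \<le>
        ereal (lipschitz_const ?T ?\<pi> \<epsilon>) * enn2ereal (d_natural I U V)"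
      by (intro estimate)
  qed
qed

end
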